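(* Consider estimating the density of $Y_1$ under reverse Kullback-Leibler loss with the constraint $\theta_1-\theta_2\in A$. Set $r=\sigma_2^2/\sigma_1^2$, $W_1=(X_1-X_2)/(1+r)$, $W_2=(rX_1+X_2)/(1+r)$, $\mu_1=(\theta_1-\theta_2)/(1+r)$, $\mu_2=(r\theta_1+\theta_2)/(1+r)$. Let $\hat q_\pi$ be the Bayes predictive density for a prior density of the form $\pi(\theta)=\pi_1(\mu_1)\,\mathbb{I}_A((1+r)\mu_1)\,\mathbb{I}_{\mathbb{R}^p}(\mu_2)$, and let $q_{\delta_{\psi_0}}(\cdot;X)\sim N_p(\delta_{\psi_0}(X),\sigma_Y^2I_p)$ be a competing plug-in predictive density with $\delta_{\psi_0}$ of the form $\delta_{\psi_0}(W_1,W_2)=\psi_0(W_1)+W_2$. Then $\hat q_\pi(\cdot;X)$ dominates $q_{\delta_{\psi_0}}(\cdot;X)$ if and only if the Bayes estimator $\psi_\pi(W_1)$ of $\mu_1$ with respect to the prior $\pi_1(\mu_1)\,\mathbb{I}_A((1+r)\mu_1)$ (and loss $\|\psi-\mu_1\|^2$) dominates $\psi_0(W_1)$ as an estimator of $\mu_1$ under loss $\|\psi-\mu_1\|^2$, for $W_1\sim N_p\big(\mu_1,\frac{\sigma_1^2}{1+r}I_p\big)$ and $(1+r)\mu_1\in A$.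
   Context: Model: $X=(X_1,X_2)$ and $Y_1$, with $X_1\sim N_p(\theta_1,\sigma_1^2I_p)$, $X_2\sim N_p(\theta_2,\sigma_2^2I_p)$, $Y_1\sim N_p(\theta_1,\sigma_Y^2I_p)$ independent, where $\sigma_1^2,\sigma_2^2,\sigma_Y^2>0$ are known and $\theta=(\theta_1,\theta_2)\in\mathbb{R}^{2p}$ satisfies $\theta_1-\theta_2\in A$ for a given $A\subset\mathbb{R}^p$. Let $q_{\theta_1}$ be the density of $Y_1$. A predictive density is a density $\hat q(\cdot;X)$ on $\mathbb{R}^p$ used to estimate $q_{\theta_1}$. Reverse Kullback-Leibler loss: $\int \hat q(y;x)\log\frac{\hat q(y;x)}{q_{\theta_1}(y)}\,dy$. Risk is the expectation of the loss under the distribution of $X$ given $\theta$. The Bayes predictive density $\hat q_\pi$ minimizes, for each $x$, the posterior expected loss over densities; Bayes quantities (posterior distributions and expectations) are assumed to exist, and priors may be improper. A procedure dominates another if its risk is less than or equal for all parameter values in the restricted parameter space, with strict inequality for at least one. *)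

theory Defs
  imports "HOL-Probability.Probability"
begin

section \<open>Decision problems with densities\<close>

text \<open>
  A model is a family \<open>f t\<close> of sampling densities, indexed by the parameter \<open>t\<close>, with respect
  to Lebesgue measure. Losses take values in \<^typ>\<open>ennreal\<close>, so that infinite losses and risks
  are genuinely infinite instead of being integrated to \<open>0\<close> as the Bochner integral would do.
\<close>

definition risk ::
  "('t \<Rightarrow> 'x::euclidean_space \<Rightarrow> real) \<Rightarrow> ('t \<Rightarrow> 'a \<Rightarrow> ennreal) \<Rightarrow> ('x \<Rightarrow> 'a) \<Rightarrow> 't \<Rightarrow> ennreal" where
  "risk f L d t = (\<integral>\<^sup>+ x. L t (d x) \<partial>density lborel (\<lambda>x. ennreal (f t x)))"

definition dominates ::
  "('t \<Rightarrow> 'x::euclidean_space \<Rightarrow> real) \<Rightarrow> ('t \<Rightarrow> 'a \<Rightarrow> ennreal) \<Rightarrow> 't set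
     \<Rightarrow> ('x \<Rightarrow> 'a) \<Rightarrow> ('x \<Rightarrow> 'a) \<Rightarrow> bool" where
  "dominates f L \<Theta> d d' \<longleftrightarrow>
     (\<forall>t\<in>\<Theta>. risk f L d t \<le> risk f L d' t) \<and> (\<exists>t\<in>\<Theta>. risk f L d t < risk f L d' t)"

text \<open>Prior densities are not required to be integrable: they may be improper.\<close>

definition prior_density :: "('t::euclidean_space \<Rightarrow> real) \<Rightarrow> bool" where
  "prior_density \<pi> \<longleftrightarrow> \<pi> \<in> borel_measurable borel \<and> (\<forall>t. 0 \<le> \<pi> t)"

definition marginal ::
  "('t::euclidean_space \<Rightarrow> 'x \<Rightarrow> real) \<Rightarrow> ('t \<Rightarrow> real) \<Rightarrow> 'x \<Rightarrow> ennreal" where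
  "marginal f \<pi> x = (\<integral>\<^sup>+ t. ennreal (f t x * \<pi> t) \<partial>lborel)"

text \<open>
  This is a probability measure exactly if the marginal at \<open>x\<close> is neither \<open>0\<close> nor infinite;
  otherwise it is not a meaningful posterior.
\<close>

definition posterior ::
  "('t::euclidean_space \<Rightarrow> 'x \<Rightarrow> real) \<Rightarrow> ('t \<Rightarrow> real) \<Rightarrow> 'x \<Rightarrow> 't measure" where
  "posterior f \<pi> x = density lborel (\<lambda>t. ennreal (f t x * \<pi> t) / marginal f \<pi> x)"

definition bayes_rule ::
  "('t::euclidean_space \<Rightarrow> 'x \<Rightarrow> real) \<Rightarrow> ('t \<Rightarrow> 'a \<Rightarrow> ennreal) \<Rightarrow> 'a set \<Rightarrow> ('t \<Rightarrow> real)
     \<Rightarrow> ('x \<Rightarrow> 'a) \<Rightarrow> bool" where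
  "bayes_rule f L \<A> \<pi> d \<longleftrightarrow>
     (\<forall>x. d x \<in> \<A> \<and>
        (\<forall>a\<in>\<A>. (\<integral>\<^sup>+ t. L t (d x) \<partial>posterior f \<pi> x) \<le> (\<integral>\<^sup>+ t. L t a \<partial>posterior f \<pi> x)))"

definition squared_error :: "'a::euclidean_space \<Rightarrow> 'a \<Rightarrow> ennreal" where
  "squared_error t a = ennreal ((norm (a - t))\<^sup>2)"

definition probability_densities :: "('a::euclidean_space \<Rightarrow> real) set" where
  "probability_densities =
     {q. q \<in> borel_measurable borel \<and> (\<forall>y. 0 \<le> q y) \<and> (\<integral>\<^sup>+ y. ennreal (q y) \<partial>lborel) = 1}"

text \<open>
  The integral of \<open>q log (q / q\<^sub>0)\<close>, as positive part minus negative part. For densities with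
  \<open>q\<^sub>0 > 0\<close> the negative part has integral at most \<open>1\<close> and the difference is nonnegative, so the
  truncating subtraction of \<^typ>\<open>ennreal\<close> is exact. Points where \<open>q y = 0\<close> contribute \<open>0\<close>.
\<close>

definition reverse_KL :: "('a::euclidean_space \<Rightarrow> real) \<Rightarrow> ('a \<Rightarrow> real) \<Rightarrow> ennreal" where
  "reverse_KL q\<^sub>0 q =
     (\<integral>\<^sup>+ y. ennreal (q y * ln (q y / q\<^sub>0 y)) \<partial>lborel)
     - (\<integral>\<^sup>+ y. ennreal (- (q y * ln (q y / q\<^sub>0 y))) \<partial>lborel)"


section \<open>The normal model\<close>

text \<open>Density of the normal law with mean \<open>m\<close> and covariance \<open>v\<close> times the identity.\<close>

definition mvn_density :: "'a::euclidean_space \<Rightarrow> real \<Rightarrow> 'a \<Rightarrow> real" where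
  "mvn_density m v y = exp (- (norm (y - m))\<^sup>2 / (2 * v)) / sqrt (2 * pi * v) ^ DIM('a)"

text \<open>Joint density of the independent pair \<open>X = (X\<^sub>1, X\<^sub>2)\<close> with variances \<open>v\<^sub>1\<close>, \<open>v\<^sub>2\<close>.\<close>

definition X_density ::
  "real \<Rightarrow> real \<Rightarrow> 'a::euclidean_space \<times> 'a \<Rightarrow> 'a \<times> 'a \<Rightarrow> real" where
  "X_density v\<^sub>1 v\<^sub>2 \<theta> x = mvn_density (fst \<theta>) v\<^sub>1 (fst x) * mvn_density (snd \<theta>) v\<^sub>2 (snd x)"

definition predictive_loss ::
  "real \<Rightarrow> 'a::euclidean_space \<times> 'a \<Rightarrow> ('a \<Rightarrow> real) \<Rightarrow> ennreal" where
  "predictive_loss v\<^sub>Y \<theta> q = reverse_KL (mvn_density (fst \<theta>) v\<^sub>Y) q"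

text \<open>
  Applied to \<open>x\<close> these two maps are \<open>W\<^sub>1\<close> and \<open>W\<^sub>2\<close>; applied to \<open>\<theta>\<close> they are \<open>\<mu>\<^sub>1\<close> and \<open>\<mu>\<^sub>2\<close>.
\<close>

definition coord1 :: "real \<Rightarrow> 'a::real_vector \<times> 'a \<Rightarrow> 'a" where
  "coord1 r z = (fst z - snd z) /\<^sub>R (1 + r)"

definition coord2 :: "real \<Rightarrow> 'a::real_vector \<times> 'a \<Rightarrow> 'a" where
  "coord2 r z = (r *\<^sub>R fst z + snd z) /\<^sub>R (1 + r)"

definition prior_\<mu>1 ::
  "('a::real_vector \<Rightarrow> real) \<Rightarrow> 'a set \<Rightarrow> real \<Rightarrow> 'a \<Rightarrow> real" where
  "prior_\<mu>1 \<pi>\<^sub>1 A r \<mu> = \<pi>\<^sub>1 \<mu> * indicator A ((1 + r) *\<^sub>R \<mu>)"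

definition prior_\<theta> ::
  "('a::real_vector \<Rightarrow> real) \<Rightarrow> 'a set \<Rightarrow> real \<Rightarrow> 'a \<times> 'a \<Rightarrow> real" where
  "prior_\<theta> \<pi>\<^sub>1 A r \<theta> =
     \<pi>\<^sub>1 (coord1 r \<theta>) * indicator A ((1 + r) *\<^sub>R coord1 r \<theta>) * indicator UNIV (coord2 r \<theta>)"

end

theory Submission
  imports Defs
begin

text \<open>
  Both sides compare squared errors. The logarithm of a normal density is quadratic in its mean, so
  the posterior expected reverse Kullback-Leibler loss of a density \<open>q\<close> equals the divergence of \<open>q\<close>
  from the normal density at the posterior mean of \<open>\<theta>\<^sub>1\<close>, plus a constant
  (\<open>average_reverse_KL\<close>). Hence the Bayes predictive density is, up to a null set, the plug-in density
  at that posterior mean (\<open>average_reverse_KL_minimizer\<close>), and its loss, like that of the competing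
  plug-in density, is the squared error of the plugged-in estimate divided by \<open>2\<sigma>\<^sub>Y\<^sup>2\<close>
  (\<open>reverse_KL_mvn\<close>).

  The coordinates \<open>(W\<^sub>1, W\<^sub>2)\<close> of the observation are independent, and the likelihood splits into one
  factor in \<open>\<mu>\<^sub>1\<close> and one in \<open>\<mu>\<^sub>2\<close> (\<open>X_density_coords\<close>). The prior is flat in \<open>\<mu>\<^sub>2\<close>, so the posterior
  mean of \<open>\<theta>\<^sub>1 = \<mu>\<^sub>1 + \<mu>\<^sub>2\<close> is \<open>\<psi>\<^sub>\<pi>(W\<^sub>1) + W\<^sub>2\<close> (\<open>posterior_mean_\<theta>\<^sub>1\<close>). Both estimates
  thus have the form \<open>\<psi>(W\<^sub>1) + W\<^sub>2\<close>, and the risk of such an estimate is the risk of \<open>\<psi>(W\<^sub>1)\<close> for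
  \<open>\<mu>\<^sub>1\<close> plus the total variance of \<open>W\<^sub>2\<close> (\<open>predictive_risk_eq\<close>). The same increasing affine
  function therefore relates the two predictive risks to the two estimation risks, and \<open>\<theta> \<mapsto> \<mu>\<^sub>1\<close>
  maps the restricted parameter space of the first problem onto that of the second.

  Two points need care. A posterior that exists at all observations automatically has finite second
  moments (\<open>posterior_second_moment_finite\<close>), which is what makes both Bayes rules unique. And risks may
  be infinite, so all computations are carried out with nonnegative integrals, where only finite
  quantities are cancelled.
\<close>

section \<open>Normal densities\<close>

lemma nn_integral_lborel_affine:
  fixes t :: "'a::euclidean_space"
  assumes [measurable]: "f \<in> borel_measurable borel" and "c \<noteq> 0"
  shows "(\<integral>\<^sup>+x. f x \<partial>lborel) = ennreal (\<bar>c\<bar> ^ DIM('a)) * (\<integral>\<^sup>+x. f (t + c *\<^sub>R x) \<partial>lborel)"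
  by (subst lborel_affine[OF \<open>c \<noteq> 0\<close>, of t])
     (simp add: nn_integral_density nn_integral_distr nn_integral_cmult)

lemma mvn_density_measurable [measurable (raw)]:
  assumes [measurable]: "f \<in> borel_measurable M" "g \<in> borel_measurable M"
  shows "(\<lambda>x. mvn_density (f x) v (g x)) \<in> borel_measurable M"
  unfolding mvn_density_def by measurable

lemma squared_error_measurable [measurable (raw)]:
  assumes [measurable]: "f \<in> borel_measurable M" "g \<in> borel_measurable M"
  shows "(\<lambda>x. squared_error (f x) (g x)) \<in> borel_measurable M"
  unfolding squared_error_def by measurable

lemma mvn_density_commute: "mvn_density m v y = mvn_density y v m"
  by (simp add: mvn_density_def norm_minus_commute)

lemma mvn_density_pos: "0 < v \<Longrightarrow> 0 < mvn_density m v y"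
  by (simp add: mvn_density_def)

lemma mvn_density_eq_prod:
  assumes "0 < v"
  shows "mvn_density m v y = (\<Prod>b\<in>Basis. normal_density (m \<bullet> b) (sqrt v) (y \<bullet> b))"
proof -
  have "(norm (y - m))\<^sup>2 = (\<Sum>b\<in>Basis. (y \<bullet> b - m \<bullet> b)\<^sup>2)"
    unfolding power2_norm_eq_inner
    by (subst euclidean_inner) (simp add: inner_diff_left power2_eq_square)
  then show ?thesis
    using assms
    by (simp add: normal_density_def mvn_density_def prod_dividef exp_sum[symmetric]
        sum_divide_distrib sum_negf)
qed

lemma nn_integral_mvn_density:
  assumes "0 < v"
  shows "(\<integral>\<^sup>+y. ennreal (mvn_density m v y) \<partial>lborel) = 1"
proof -
  have 1: "(\<integral>\<^sup>+x. ennreal (normal_density a (sqrt v) x) \<partial>lborel) = 1" for a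
    using assms
    by (subst nn_integral_eq_integral) (auto simp: integral_normal_density)
  show ?thesis
    unfolding mvn_density_eq_prod[OF assms]
    by (subst prod_ennreal[symmetric], simp, subst nn_integral_lborel_prod) (simp_all add: 1)
qed

lemma mvn_density_in_probability_densities:
  "0 < v \<Longrightarrow> mvn_density m v \<in> probability_densities"
  by (auto simp: probability_densities_def nn_integral_mvn_density less_imp_le[OF mvn_density_pos])

lemma prob_space_mvn:
  assumes "0 < v"
  shows "prob_space (density lborel (\<lambda>y. ennreal (mvn_density m v y)))"
  by (rule prob_spaceI) (simp add: emeasure_density nn_integral_mvn_density assms)

section \<open>Means through the parallel axis identity\<close>

text \<open>
  The mean and total variance of a random vector, recorded through the only identity that is used
  about them. Stated with nonnegative integrals for all \<open>y\<close> at once, it can be added, translated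
  and averaged without integrability side conditions, and it determines \<open>m\<close>. The name recalls the
  parallel axis theorem for moments of inertia.
\<close>

definition parallel_axis ::
  "'b measure \<Rightarrow> ('b \<Rightarrow> 'a::euclidean_space) \<Rightarrow> 'a \<Rightarrow> real \<Rightarrow> bool" where
  "parallel_axis M T m V \<longleftrightarrow> T \<in> borel_measurable M \<and> 0 \<le> V \<and>
     (\<forall>y. (\<integral>\<^sup>+\<omega>. squared_error (T \<omega>) y \<partial>M) = squared_error m y + ennreal V)"

lemma parallel_axisD:
  assumes "parallel_axis M T m V"
  shows "T \<in> borel_measurable M" "0 \<le> V"
    "(\<integral>\<^sup>+\<omega>. squared_error (T \<omega>) y \<partial>M) = squared_error m y + ennreal V"
  using assms by (auto simp: parallel_axis_def)

text \<open>
  A finite second moment about one point makes \<open>T\<close> integrable, and then the cross term in the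
  expansion of \<open>\<parallel>y - T\<parallel>\<^sup>2\<close> about the mean integrates to \<open>0\<close>.
\<close>

lemma parallel_axis_expectation:
  assumes "prob_space M" and T[measurable]: "T \<in> borel_measurable M"
    and fin: "(\<integral>\<^sup>+\<omega>. squared_error (T \<omega>) a \<partial>M) < \<infinity>"
  shows "\<exists>V. parallel_axis M T (integral\<^sup>L M T) V"
proof -
  interpret prob_space M by fact
  define m where "m = integral\<^sup>L M T"
  have i1: "integrable M (\<lambda>\<omega>. (norm (a - T \<omega>))\<^sup>2)"
    using fin by (intro integrableI_nonneg) (auto simp: squared_error_def)
  have i2: "integrable M (\<lambda>\<omega>. a - T \<omega>)"
  proof (rule Bochner_Integration.integrable_bound)
    show "integrable M (\<lambda>\<omega>. 1 + (norm (a - T \<omega>))\<^sup>2)" using i1 by simp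
    have "u \<le> 1 + u\<^sup>2" for u :: real
      using zero_le_power2[of "u - 1/2"] by (simp add: power2_eq_square algebra_simps)
    then show "AE x in M. norm (a - T x) \<le> norm (1 + (norm (a - T x))\<^sup>2)"
      by (auto intro: order_trans[OF _ abs_ge_self])
  qed simp
  have i3: "integrable M T"
    using Bochner_Integration.integrable_diff[OF integrable_const i2, of a] by simp
  have exp: "(norm (y - T \<omega>))\<^sup>2 = (norm (y - a))\<^sup>2 + (norm (a - T \<omega>))\<^sup>2 + 2 * ((y - a) \<bullet> (a - T \<omega>))" for y \<omega>
    by (simp add: power2_norm_eq_inner algebra_simps inner_commute)
  have i4: "integrable M (\<lambda>\<omega>. (norm (y - T \<omega>))\<^sup>2)" for y
    unfolding exp[of y] by (intro Bochner_Integration.integrable_add integrable_const i1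
        Bochner_Integration.integrable_mult_right integrable_inner_right i2)
  define V where "V = (\<integral>\<omega>. (norm (m - T \<omega>))\<^sup>2 \<partial>M)"
  have V0: "0 \<le> V" by (simp add: V_def)
  have "(\<integral>\<omega>. (norm (y - T \<omega>))\<^sup>2 \<partial>M) = (norm (y - m))\<^sup>2 + V" for y
  proof -
    have "(norm (y - T \<omega>))\<^sup>2 = (norm (y - m))\<^sup>2 + (norm (m - T \<omega>))\<^sup>2 + 2 * ((y - m) \<bullet> (m - T \<omega>))" for \<omega>
      by (simp add: power2_norm_eq_inner algebra_simps inner_commute)
    moreover have "(\<integral>\<omega>. 2 * ((y - m) \<bullet> (m - T \<omega>)) \<partial>M) = 0"
      using i3 by (simp add: m_def prob_space)
    ultimately show ?thesis
      using i4[of m] i3 by (simp add: V_def prob_space)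
  qed
  then have "(\<integral>\<^sup>+\<omega>. squared_error (T \<omega>) y \<partial>M) = squared_error m y + ennreal V" for y
    unfolding squared_error_def
    by (subst nn_integral_eq_integral[OF i4]) (simp_all add: V0)
  then show ?thesis
    unfolding parallel_axis_def m_def[symmetric] by (intro exI[of _ V]) (simp add: V0)
qed

text \<open>
  With \<open>t = \<parallel>m - y\<parallel>\<^sup>2 / (4 v)\<close> the inequality \<open>t exp (- 2 t) \<le> exp (- t)\<close> bounds the integrand by a multiple of the
  normal density with variance \<open>2 v\<close>.
\<close>

lemma nn_integral_mvn_squared_error_finite:
  fixes m :: "'a::euclidean_space"
  assumes "0 < v"
  shows "(\<integral>\<^sup>+y. squared_error y m \<partial>density lborel (\<lambda>y. ennreal (mvn_density m v y))) < \<infinity>"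
proof -
  define C where "C = 4 * v * sqrt (2 * pi * (2 * v)) ^ DIM('a) / sqrt (2 * pi * v) ^ DIM('a)"
  have C0: "0 \<le> C" using assms by (simp add: C_def)
  have "mvn_density m v y * (norm (m - y))\<^sup>2 \<le> C * mvn_density m (2 * v) y" for y :: 'a
  proof -
    define t where "t = (norm (m - y))\<^sup>2 / (4 * v)"
    have "t * exp (- (2 * t)) \<le> exp t * exp (- (2 * t))"
      by (intro mult_right_mono) (use exp_ge_add_one_self[of t] in linarith, simp)
    also have "\<dots> = exp (- t)" by (simp add: exp_add[symmetric])
    finally have *: "4 * v * t * exp (- (2 * t)) / sqrt (2 * pi * v) ^ DIM('a)
        \<le> 4 * v * exp (- t) / sqrt (2 * pi * v) ^ DIM('a)"
      using assms by (intro divide_right_mono) auto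
    have "(norm (m - y))\<^sup>2 = 4 * v * t" using assms by (simp add: t_def)
    moreover have "mvn_density m v y = exp (- (2 * t)) / sqrt (2 * pi * v) ^ DIM('a)"
      using assms by (simp add: mvn_density_def t_def norm_minus_commute)
    moreover have "mvn_density m (2 * v) y = exp (- t) / sqrt (2 * pi * (2 * v)) ^ DIM('a)"
      using assms by (simp add: mvn_density_def t_def norm_minus_commute)
    moreover have "sqrt (2 * pi * (2 * v)) ^ DIM('a) > 0" using assms by simp
    ultimately show ?thesis using * unfolding C_def
      by (simp add: mult_ac)
  qed
  then have "ennreal (mvn_density m v y) * squared_error y m
      \<le> ennreal C * ennreal (mvn_density m (2 * v) y)" for y
    using assms C0 unfolding squared_error_def
    by (simp add: ennreal_mult[symmetric] less_imp_le[OF mvn_density_pos] ennreal_leI)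
  then have "(\<integral>\<^sup>+y. ennreal (mvn_density m v y) * squared_error y m \<partial>lborel)
      \<le> (\<integral>\<^sup>+y. ennreal C * ennreal (mvn_density m (2 * v) y) \<partial>lborel)"
    by (intro nn_integral_mono) auto
  also have "\<dots> < \<infinity>"
    using assms by (simp add: nn_integral_cmult nn_integral_mvn_density)
  finally show ?thesis by (simp add: nn_integral_density)
qed

text \<open>
  The density is invariant under the reflection \<open>y \<mapsto> 2 m - y\<close>, so its mean is a fixed point of that
  reflection; this spares the computation of any integral. No value is
  claimed for the variance: it contributes the same constant to the risks that are compared.
\<close>

lemma parallel_axis_mvn:
  fixes m :: "'a::euclidean_space"
  assumes "0 < v"
  shows "\<exists>V. parallel_axis (density lborel (\<lambda>y. ennreal (mvn_density m v y))) (\<lambda>y. y) m V"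
proof -
  let ?N = "density lborel (\<lambda>y::'a. ennreal (mvn_density m v y))"
  obtain V where V: "parallel_axis ?N (\<lambda>y. y) (integral\<^sup>L ?N (\<lambda>y. y)) V" (is "parallel_axis _ _ ?m _")
    using parallel_axis_expectation[OF prob_space_mvn[OF assms] _
        nn_integral_mvn_squared_error_finite[OF assms]] by auto
  (* reflecting y is the same as reflecting the point from which the error is measured *)
  have reflect: "(\<integral>\<^sup>+y. squared_error y a \<partial>?N) = (\<integral>\<^sup>+y. squared_error y (2 *\<^sub>R m - a) \<partial>?N)" for a
  proof -
    have "mvn_density m v (2 *\<^sub>R m - y) = mvn_density m v y" for y :: 'a
    proof -
      have "2 *\<^sub>R m - y - m = - (y - m)" by (simp add: scaleR_2)
      then show ?thesis unfolding mvn_density_def by (simp only: norm_minus_cancel)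
    qed
    moreover have "squared_error (2 *\<^sub>R m - y) a = squared_error y (2 *\<^sub>R m - a)" for y
    proof -
      have "2 *\<^sub>R m - a - y = - (a - (2 *\<^sub>R m - y))" by simp
      then show ?thesis unfolding squared_error_def by (simp only: norm_minus_cancel)
    qed
    ultimately show ?thesis
      by (simp add: nn_integral_density)
         (subst nn_integral_lborel_affine[where c = "-1" and t = "2 *\<^sub>R m"], simp_all)
  qed
  have "squared_error ?m (2 *\<^sub>R m - ?m) = squared_error ?m ?m"
    using reflect[of ?m] by (simp add: parallel_axisD(3)[OF V] add.commute[of _ "ennreal V"] ennreal_add_left_cancel)
  then have "2 *\<^sub>R m = 2 *\<^sub>R ?m"
    by (simp add: squared_error_def scaleR_2 ennreal_eq_0_iff algebra_simps)
  then have "?m = m" by simp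
  with V show ?thesis by auto
qed

lemma squared_error_minimizer_unique:
  assumes "parallel_axis M T m V"
    and "\<forall>a. (\<integral>\<^sup>+\<omega>. squared_error (T \<omega>) d \<partial>M) \<le> (\<integral>\<^sup>+\<omega>. squared_error (T \<omega>) a \<partial>M)"
  shows "d = m"
proof -
  have "squared_error m d + ennreal V \<le> squared_error m m + ennreal V"
    using assms by (metis parallel_axisD(3))
  then show ?thesis
    by (simp add: squared_error_def add.commute[of _ "ennreal V"] ennreal_add_left_cancel_le)
qed


section \<open>Reverse Kullback-Leibler loss\<close>

text \<open>
  The integrand \<open>a log (a / b)\<close> of the divergence, corrected by \<open>b - a\<close>. Between densities of mass \<open>1\<close>
  the correction integrates to \<open>0\<close>, but it makes the integrand nonnegative, so that Tonelli's theorem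
  applies without any integrability assumption on the predictive density.
\<close>

definition kl_integrand :: "real \<Rightarrow> real \<Rightarrow> real" where
  "kl_integrand a b = a * ln (a / b) - a + b"

lemma kl_integrand_nonneg:
  assumes "0 \<le> a" "0 < b"
  shows "0 \<le> kl_integrand a b"
proof (cases "a = 0")
  case False
  with assms have "0 < a" by simp
  then have "ln (b / a) \<le> b / a - 1" using assms by (intro ln_le_minus_one) simp
  then have "a * ln (b / a) \<le> a * (b / a - 1)" using \<open>0 < a\<close> by (intro mult_left_mono) auto
  then show ?thesis using \<open>0 < a\<close> \<open>0 < b\<close>
    by (simp add: kl_integrand_def ln_div algebra_simps)
qed (use assms in \<open>simp add: kl_integrand_def\<close>)

lemma kl_integrand_eq_0_iff:
  assumes "0 \<le> a" "0 < b"
  shows "kl_integrand a b = 0 \<longleftrightarrow> a = b"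
proof
  assume eq: "kl_integrand a b = 0"
  with assms have "0 < a" by (cases "a = 0") (auto simp: kl_integrand_def)
  then have "a * ln (b / a) = a * (b / a - 1)"
    using eq assms by (simp add: kl_integrand_def ln_div algebra_simps)
  then have "ln (b / a) = b / a - 1" using \<open>0 < a\<close> by simp
  then have "b / a = 1" using \<open>0 < a\<close> \<open>0 < b\<close> by (intro ln_eq_minus_one) auto
  then show "a = b" by simp
qed (use assms in \<open>simp add: kl_integrand_def\<close>)

lemma kl_integrand_measurable [measurable (raw)]:
  assumes [measurable]: "f \<in> borel_measurable M" "g \<in> borel_measurable M"
  shows "(\<lambda>x. kl_integrand (f x) (g x)) \<in> borel_measurable M"
  unfolding kl_integrand_def by measurable

lemma ennreal_add_one_cancel: "a + 1 = b + 1 \<Longrightarrow> a = b" for a b :: ennreal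
  using ennreal_add_left_cancel[of 1 a b] by (simp add: add.commute)

lemma probability_densitiesD:
  assumes "q \<in> probability_densities"
  shows "q \<in> borel_measurable borel" "0 \<le> q y" "(\<integral>\<^sup>+y. ennreal (q y) \<partial>lborel) = 1"
  using assms by (auto simp: probability_densities_def)

text \<open>
  Pointwise, positive part plus \<open>g\<close> equals corrected integrand plus negative part plus \<open>q\<close>. Both
  densities have mass \<open>1\<close> and the negative part is at most \<open>g\<close>, so everything but the divergence
  cancels.
\<close>

lemma reverse_KL_eq_nn_integral:
  assumes q: "q \<in> probability_densities" and g: "g \<in> probability_densities" and pos: "\<And>y. 0 < g y"
  shows "reverse_KL g q = (\<integral>\<^sup>+y. ennreal (kl_integrand (q y) (g y)) \<partial>lborel)" (is "_ = ?K")
proof -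
  note [measurable] = probability_densitiesD(1)[OF q] probability_densitiesD(1)[OF g]
  let ?P = "\<integral>\<^sup>+y. ennreal (q y * ln (q y / g y)) \<partial>lborel"
  let ?N = "\<integral>\<^sup>+y. ennreal (- (q y * ln (q y / g y))) \<partial>lborel"
  have nn: "0 \<le> kl_integrand (q y) (g y)" for y
    using probability_densitiesD(2)[OF q] pos by (rule kl_integrand_nonneg)
  have pw: "ennreal (q y * ln (q y / g y)) + ennreal (g y)
      = ennreal (kl_integrand (q y) (g y)) + ennreal (- (q y * ln (q y / g y))) + ennreal (q y)" for y
  proof (cases "0 \<le> q y * ln (q y / g y)")
    case True
    then show ?thesis
      using nn[of y] pos[of y] probability_densitiesD(2)[OF q, of y]
      by (simp add: ennreal_neg ennreal_plus[symmetric] kl_integrand_def del: ennreal_plus)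
  next
    case False
    then show ?thesis
      using nn[of y] pos[of y] probability_densitiesD(2)[OF q, of y]
      by (simp add: ennreal_neg ennreal_plus[symmetric] kl_integrand_def del: ennreal_plus)
  qed
  have "?P + 1 = (\<integral>\<^sup>+y. ennreal (q y * ln (q y / g y)) + ennreal (g y) \<partial>lborel)"
    using probability_densitiesD(3)[OF g] by (simp add: nn_integral_add)
  also have "\<dots> = ?K + ?N + 1"
    unfolding pw using probability_densitiesD(3)[OF q] by (simp add: nn_integral_add)
  finally have "?P = ?K + ?N"
    by (rule ennreal_add_one_cancel)
  moreover have "?N \<le> 1"
  proof -
    have "?N \<le> (\<integral>\<^sup>+y. ennreal (g y) \<partial>lborel)"
      using nn probability_densitiesD(2)[OF q]
      by (intro nn_integral_mono ennreal_leI) (simp add: kl_integrand_def, smt (verit))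
    then show ?thesis using probability_densitiesD(3)[OF g] by simp
  qed
  then have "?N \<noteq> \<top>" by (auto simp: top_unique)
  ultimately show ?thesis by (simp add: reverse_KL_def)
qed

text \<open>
  The logarithm of a normal density is quadratic in its mean; hence replacing the mean \<open>m\<close> by \<open>t\<close>
  changes the divergence only by a difference of squared errors. All terms are moved to the side
  where they are positive, so that the identity survives in the extended nonnegative reals.
\<close>

lemma kl_integrand_mvn_change_mean:
  assumes "0 < v" "0 \<le> a"
  shows "ennreal (kl_integrand a (mvn_density t v y))
      + (ennreal (a / (2 * v)) * squared_error m y + ennreal (mvn_density m v y))
    = ennreal (kl_integrand a (mvn_density m v y))
      + ennreal (a / (2 * v)) * squared_error t y + ennreal (mvn_density t v y)"
proof -
  have ln_mvn: "ln (mvn_density s v y) = - ((norm (y - s))\<^sup>2 / (2 * v)) - ln (sqrt (2 * pi * v) ^ DIM('a))" for s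
    using assms by (simp add: mvn_density_def ln_div)
  have "kl_integrand a (mvn_density t v y) + (a / (2 * v) * (norm (y - m))\<^sup>2 + mvn_density m v y)
      = kl_integrand a (mvn_density m v y) + a / (2 * v) * (norm (y - t))\<^sup>2 + mvn_density t v y"
  proof (cases "a = 0")
    case False
    with assms have "0 < a" by simp
    have "ln (a / mvn_density s v y)
      = ln a + (norm (y - s))\<^sup>2 / (2 * v) + ln (sqrt (2 * pi * v) ^ DIM('a))" for s
      using \<open>0 < a\<close> mvn_density_pos[OF \<open>0 < v\<close>, of s y] by (simp add: ln_div ln_mvn)
    then show ?thesis by (simp add: kl_integrand_def algebra_simps)
  qed (simp add: kl_integrand_def)
  then show ?thesis
    using assms mvn_density_pos[OF \<open>0 < v\<close>, of t y] mvn_density_pos[OF \<open>0 < v\<close>, of m y]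
    by (simp add: squared_error_def ennreal_mult[symmetric] ennreal_plus[symmetric]
        kl_integrand_nonneg del: ennreal_plus)
qed

text \<open>
  Averaging over the mean of the target amounts to a divergence from the normal law at the average
  mean, plus a constant: by the preceding identity the squared errors average according to the
  parallel axis identity, and the mixture of normal densities that remains has mass \<open>1\<close> like the
  density at \<open>m\<close>.
\<close>

lemma average_reverse_KL:
  fixes T :: "'b \<Rightarrow> 'a::euclidean_space"
  assumes M: "prob_space M" and T: "parallel_axis M T m V" and v: "0 < v"
    and q: "q \<in> probability_densities"
  shows "(\<integral>\<^sup>+\<omega>. reverse_KL (mvn_density (T \<omega>) v) q \<partial>M)
    = reverse_KL (mvn_density m v) q + ennreal (V / (2 * v))"
proof -
  interpret prob_space M by fact
  interpret P: pair_sigma_finite M "lborel :: 'a measure" ..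
  note [measurable] = parallel_axisD(1)[OF T] probability_densitiesD(1)[OF q]
  note q0 = probability_densitiesD(2)[OF q]
  have V: "0 \<le> V" using T by (rule parallel_axisD)
  let ?k = "\<lambda>t y. ennreal (kl_integrand (q y) (mvn_density t v y))"
  let ?p = "\<lambda>y. \<integral>\<^sup>+\<omega>. ennreal (mvn_density (T \<omega>) v y) \<partial>M"
  have KL: "reverse_KL (mvn_density t v) q = (\<integral>\<^sup>+y. ?k t y \<partial>lborel)" for t
    using q v by (intro reverse_KL_eq_nn_integral mvn_density_in_probability_densities mvn_density_pos)
  (* average the change of mean identity over t = T \<omega> and cancel the finite squared error at m *)
  have pw: "(\<integral>\<^sup>+\<omega>. ?k (T \<omega>) y \<partial>M) + ennreal (mvn_density m v y)
      = ?k m y + ennreal (V / (2 * v)) * ennreal (q y) + ?p y" for y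
  proof -
    let ?c = "ennreal (q y / (2 * v))"
    have "(\<integral>\<^sup>+\<omega>. ?k (T \<omega>) y \<partial>M) + (?c * squared_error m y + ennreal (mvn_density m v y))
      = (\<integral>\<^sup>+\<omega>. ?k (T \<omega>) y + (?c * squared_error m y + ennreal (mvn_density m v y)) \<partial>M)"
      by (simp add: nn_integral_add emeasure_space_1)
    also have "\<dots> = (\<integral>\<^sup>+\<omega>. ?k m y + ?c * squared_error (T \<omega>) y + ennreal (mvn_density (T \<omega>) v y) \<partial>M)"
      by (intro nn_integral_cong kl_integrand_mvn_change_mean v q0)
    also have "\<dots> = ?k m y + ?c * (squared_error m y + ennreal V) + ?p y"
      by (simp add: nn_integral_add nn_integral_cmult emeasure_space_1 parallel_axisD(3)[OF T])
    finally have "?c * squared_error m y + ((\<integral>\<^sup>+\<omega>. ?k (T \<omega>) y \<partial>M) + ennreal (mvn_density m v y))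
        = ?c * squared_error m y + (?k m y + ?c * ennreal V + ?p y)"
      by (simp only: distrib_left distrib_right ac_simps)
    moreover have "?c * squared_error m y \<noteq> \<infinity>"
      by (simp add: squared_error_def ennreal_mult_eq_top_iff)
    moreover have "?c * ennreal V = ennreal (V / (2 * v)) * ennreal (q y)"
      using v q0[of y] V by (simp add: ennreal_mult[symmetric] mult.commute)
    ultimately show ?thesis by (simp only: ennreal_add_left_cancel) simp
  qed
  have p1: "(\<integral>\<^sup>+y. ?p y \<partial>lborel) = 1"
    by (subst P.Fubini') (simp_all add: nn_integral_mvn_density v emeasure_space_1)
  have "(\<integral>\<^sup>+y. (\<integral>\<^sup>+\<omega>. ?k (T \<omega>) y \<partial>M) \<partial>lborel) + 1
    = (\<integral>\<^sup>+y. (\<integral>\<^sup>+\<omega>. ?k (T \<omega>) y \<partial>M) + ennreal (mvn_density m v y) \<partial>lborel)"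
    by (simp add: nn_integral_add nn_integral_mvn_density v)
  also have "\<dots> = (\<integral>\<^sup>+y. ?k m y \<partial>lborel) + ennreal (V / (2 * v)) + 1"
    unfolding pw
    by (simp add: nn_integral_add nn_integral_cmult probability_densitiesD(3)[OF q] p1)
  finally have "(\<integral>\<^sup>+y. (\<integral>\<^sup>+\<omega>. ?k (T \<omega>) y \<partial>M) \<partial>lborel) = (\<integral>\<^sup>+y. ?k m y \<partial>lborel) + ennreal (V / (2 * v))"
    by (rule ennreal_add_one_cancel)
  then show ?thesis
    unfolding KL by (subst (asm) P.Fubini') simp_all
qed

lemma reverse_KL_self:
  assumes "0 < v"
  shows "reverse_KL (mvn_density m v) (mvn_density m v) = 0"
  using assms by (subst reverse_KL_eq_nn_integral)
    (simp_all add: mvn_density_in_probability_densities mvn_density_pos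
      less_imp_neq[OF mvn_density_pos, symmetric] kl_integrand_def)

text \<open>
  The change of mean identity with \<open>a\<close> the density at \<open>d\<close> itself: the divergence at \<open>d\<close> vanishes, and
  the squared errors integrate by the parallel axis identity for the normal law at \<open>d\<close>.
\<close>

lemma reverse_KL_mvn:
  fixes t d :: "'a::euclidean_space"
  assumes v: "0 < v"
  shows "reverse_KL (mvn_density t v) (mvn_density d v) = ennreal (1 / (2 * v)) * squared_error t d"
proof -
  obtain V where V: "parallel_axis (density lborel (\<lambda>y. ennreal (mvn_density d v y))) (\<lambda>y. y) d V"
    using parallel_axis_mvn[OF v] by blast
  have S: "(\<integral>\<^sup>+y. ennreal (mvn_density d v y / (2 * v)) * squared_error a y \<partial>lborel)
      = ennreal (1 / (2 * v)) * (squared_error d a + ennreal V)" for a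
  proof -
    have "ennreal (mvn_density d v y / (2 * v)) * squared_error a y
        = ennreal (1 / (2 * v)) * (ennreal (mvn_density d v y) * squared_error y a)" for y
      using v less_imp_le[OF mvn_density_pos[OF v, of d y]]
      by (simp add: squared_error_def ennreal_mult[symmetric] norm_minus_commute)
    then show ?thesis
      using parallel_axisD(3)[OF V, of a] by (simp add: nn_integral_density nn_integral_cmult)
  qed
  let ?k = "\<lambda>t y. ennreal (kl_integrand (mvn_density d v y) (mvn_density t v y))"
  have KL: "reverse_KL (mvn_density t v) (mvn_density d v) = (\<integral>\<^sup>+y. ?k t y \<partial>lborel)" for t
    using v by (intro reverse_KL_eq_nn_integral mvn_density_in_probability_densities mvn_density_pos)
  have "(\<integral>\<^sup>+y. ?k t y \<partial>lborel) + (ennreal (1 / (2 * v)) * (squared_error d d + ennreal V) + 1)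
      = (\<integral>\<^sup>+y. ?k t y + (ennreal (mvn_density d v y / (2 * v)) * squared_error d y + ennreal (mvn_density d v y)) \<partial>lborel)"
    by (simp add: nn_integral_add S nn_integral_mvn_density v)
  also have "\<dots> = (\<integral>\<^sup>+y. ?k d y + ennreal (mvn_density d v y / (2 * v)) * squared_error t y + ennreal (mvn_density t v y) \<partial>lborel)"
    by (subst kl_integrand_mvn_change_mean[OF v]) (simp_all add: less_imp_le[OF mvn_density_pos] v)
  also have "\<dots> = ennreal (1 / (2 * v)) * (squared_error d t + ennreal V) + 1"
    using KL[of d] by (simp add: nn_integral_add S nn_integral_mvn_density v reverse_KL_self)
  finally have "(ennreal (1 / (2 * v)) * ennreal V + 1) + (\<integral>\<^sup>+y. ?k t y \<partial>lborel)
      = (ennreal (1 / (2 * v)) * ennreal V + 1) + ennreal (1 / (2 * v)) * squared_error t d"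
    by (simp add: squared_error_def norm_minus_commute distrib_left add.assoc add.commute add.left_commute)
  moreover have "ennreal (1 / (2 * v)) * ennreal V + 1 \<noteq> \<infinity>"
    by (simp add: ennreal_mult_eq_top_iff)
  ultimately show ?thesis
    unfolding KL by (simp only: ennreal_add_left_cancel) simp
qed

lemma reverse_KL_eq_0_imp_AE_eq:
  assumes q: "q \<in> probability_densities" and g: "g \<in> probability_densities" and pos: "\<And>y. 0 < g y"
    and 0: "reverse_KL g q = 0"
  shows "AE y in lborel. q y = g y"
proof -
  note [measurable] = probability_densitiesD(1)[OF q] probability_densitiesD(1)[OF g]
  have nn: "0 \<le> kl_integrand (q y) (g y)" for y
    using probability_densitiesD(2)[OF q] pos by (rule kl_integrand_nonneg)
  have "AE y in lborel. ennreal (kl_integrand (q y) (g y)) = 0"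
    using 0 unfolding reverse_KL_eq_nn_integral[OF q g pos]
    by (subst (asm) nn_integral_0_iff_AE) simp_all
  then show ?thesis
  proof eventually_elim
    case (elim y)
    then have "kl_integrand (q y) (g y) = 0" using nn[of y] by (simp add: ennreal_eq_0_iff)
    then show ?case using probability_densitiesD(2)[OF q, of y] pos[of y] by (simp add: kl_integrand_eq_0_iff)
  qed
qed

lemma reverse_KL_cong_AE:
  assumes "AE y in lborel. q y = q' y"
  shows "reverse_KL g q = reverse_KL g q'"
proof -
  have "(\<integral>\<^sup>+y. ennreal (q y * ln (q y / g y)) \<partial>lborel) = (\<integral>\<^sup>+y. ennreal (q' y * ln (q' y / g y)) \<partial>lborel)"
    using assms by (intro nn_integral_cong_AE) auto
  moreover have "(\<integral>\<^sup>+y. ennreal (- (q y * ln (q y / g y))) \<partial>lborel) = (\<integral>\<^sup>+y. ennreal (- (q' y * ln (q' y / g y))) \<partial>lborel)"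
    using assms by (intro nn_integral_cong_AE) auto
  ultimately show ?thesis by (simp add: reverse_KL_def)
qed

text \<open>
  The Bayes predictive density is the plug-in density at the posterior mean: by the averaging
  formula, a minimizer has divergence \<open>0\<close> from the normal density at \<open>m\<close>, so it agrees with that
  density almost everywhere. The conclusion is phrased as the loss of the minimizer, since the
  values on a null set remain undetermined.
\<close>

lemma average_reverse_KL_minimizer:
  assumes M: "prob_space M" and T: "parallel_axis M T m V" and v: "0 < v"
    and q: "q \<in> probability_densities"
    and min: "\<forall>a\<in>probability_densities. (\<integral>\<^sup>+\<omega>. reverse_KL (mvn_density (T \<omega>) v) q \<partial>M)
       \<le> (\<integral>\<^sup>+\<omega>. reverse_KL (mvn_density (T \<omega>) v) a \<partial>M)"
  shows "reverse_KL (mvn_density t v) q = ennreal (1 / (2 * v)) * squared_error t m"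
proof -
  note g = mvn_density_in_probability_densities[OF v]
  have "reverse_KL (mvn_density m v) q + ennreal (V / (2 * v)) \<le> ennreal (V / (2 * v))"
    using bspec[OF min g[of m]] by (simp add: average_reverse_KL[OF M T v] q g reverse_KL_self v)
  then have "reverse_KL (mvn_density m v) q = 0"
    using ennreal_add_left_cancel_le[of "ennreal (V / (2 * v))" "reverse_KL (mvn_density m v) q" 0]
    by (simp add: add.commute)
  then have "AE y in lborel. q y = mvn_density m v y"
    using mvn_density_pos[OF v] by (intro reverse_KL_eq_0_imp_AE_eq q g)
  then show ?thesis
    using reverse_KL_cong_AE reverse_KL_mvn[OF v] by metis
qed


section \<open>Posterior distributions\<close>

lemma nn_integral_posterior:
  assumes [measurable]: "(\<lambda>t. f t x * \<pi> t) \<in> borel_measurable borel" "F \<in> borel_measurable borel"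
  shows "(\<integral>\<^sup>+t. F t \<partial>posterior f \<pi> x)
    = (\<integral>\<^sup>+t. ennreal (f t x * \<pi> t) * F t \<partial>lborel) / marginal f \<pi> x"
proof -
  have "(\<integral>\<^sup>+t. F t \<partial>posterior f \<pi> x)
      = (\<integral>\<^sup>+t. ennreal (f t x * \<pi> t) / marginal f \<pi> x * F t \<partial>lborel)"
    unfolding posterior_def by (simp add: nn_integral_density)
  also have "\<dots> = (\<integral>\<^sup>+t. inverse (marginal f \<pi> x) * (ennreal (f t x * \<pi> t) * F t) \<partial>lborel)"
    unfolding divide_ennreal_def by (simp only: mult_ac)
  also have "\<dots> = inverse (marginal f \<pi> x) * (\<integral>\<^sup>+t. ennreal (f t x * \<pi> t) * F t \<partial>lborel)"
    by (simp add: nn_integral_cmult)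
  finally show ?thesis
    unfolding divide_ennreal_def by (simp only: mult.commute)
qed

lemma prob_space_posterior_iff:
  assumes [measurable]: "(\<lambda>t. f t x * \<pi> t) \<in> borel_measurable borel"
  shows "prob_space (posterior f \<pi> x) \<longleftrightarrow> marginal f \<pi> x \<noteq> 0 \<and> marginal f \<pi> x \<noteq> \<infinity>"
proof -
  have "emeasure (posterior f \<pi> x) (space (posterior f \<pi> x)) = marginal f \<pi> x / marginal f \<pi> x"
    using nn_integral_posterior[where f = f and x = x and \<pi> = \<pi> and F = "\<lambda>_. 1"]
    by (simp add: marginal_def)
  also have "\<dots> = 1 \<longleftrightarrow> marginal f \<pi> x \<noteq> 0 \<and> marginal f \<pi> x \<noteq> \<infinity>"
    by (cases "marginal f \<pi> x" rule: ennreal_cases)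
       (auto simp: divide_ennreal ennreal_divide_self top_unique ennreal_top_divide)
  finally show ?thesis by (auto intro: prob_spaceI dest: prob_space.emeasure_space_1)
qed

text \<open>
  A Bayes rule is characterised separately at each \<open>x\<close>, which says nothing about measurability; the
  formula for the posterior mean supplies what is needed to apply Tonelli's theorem to its risk.
\<close>

lemma posterior_mean_measurable:
  fixes f :: "'t::euclidean_space \<Rightarrow> 'x::euclidean_space \<Rightarrow> real"
  assumes [measurable]: "(\<lambda>(x, t). f t x * \<pi> t) \<in> borel_measurable (borel \<Otimes>\<^sub>M borel)"
    and nn: "\<And>t x. 0 \<le> f t x * \<pi> t" and prob: "\<And>x. prob_space (posterior f \<pi> x)"
  shows "(\<lambda>x. integral\<^sup>L (posterior f \<pi> x) (\<lambda>t. t)) \<in> borel_measurable borel"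
proof -
  have m[measurable]: "(\<lambda>t. f t x * \<pi> t) \<in> borel_measurable borel" for x by measurable
  have "ennreal (f t x * \<pi> t) / marginal f \<pi> x = ennreal (f t x * \<pi> t / enn2real (marginal f \<pi> x))" for t x
    using prob[of x] nn[of t x] unfolding prob_space_posterior_iff[OF m]
    by (cases "marginal f \<pi> x" rule: ennreal_cases) (auto simp: divide_ennreal less_le)
  then have "integral\<^sup>L (posterior f \<pi> x) (\<lambda>t. t)
      = (\<integral>t. (f t x * \<pi> t / enn2real (marginal f \<pi> x)) *\<^sub>R t \<partial>lborel)" for x
    unfolding posterior_def by (simp add: integral_density nn)
  moreover have [measurable]: "(\<lambda>x. marginal f \<pi> x) \<in> borel_measurable borel"
    unfolding marginal_def by measurable
  ultimately show ?thesis by simp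
qed

lemma sum_exp_ge_square: "t\<^sup>2 \<le> 2 * (exp t + exp (- t))" for t :: real
proof -
  have *: "s\<^sup>2 \<le> 2 * exp s" if "0 \<le> s" for s :: real
    using exp_lower_Taylor_quadratic[OF that] that by simp
  show ?thesis
  proof (cases "0 \<le> t")
    case True
    then have "t\<^sup>2 \<le> 2 * exp t" by (rule *)
    also have "\<dots> \<le> 2 * (exp t + exp (- t))" by simp
    finally show ?thesis .
  next
    case False
    then have "t\<^sup>2 \<le> 2 * exp (- t)" using *[of "- t"] by simp
    also have "\<dots> \<le> 2 * (exp t + exp (- t))" by simp
    finally show ?thesis .
  qed
qed

text \<open>
  Shifting the observation by \<open>\<plusminus> v b\<close> multiplies the normal likelihood by the exponential of \<open>\<mp>\<close> the
  \<open>b\<close>-coordinate of \<open>w - \<mu>\<close>, up to the constant \<open>exp (- v / 2)\<close>; the two exponentials together dominate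
  the square of that coordinate.
\<close>

lemma mvn_squared_error_le_shifts:
  fixes \<mu> w :: "'a::euclidean_space"
  assumes v: "0 < v"
  shows "mvn_density \<mu> v w * (norm (w - \<mu>))\<^sup>2
    \<le> 2 * exp (v / 2) * (\<Sum>b\<in>Basis. mvn_density \<mu> v (w + v *\<^sub>R b) + mvn_density \<mu> v (w - v *\<^sub>R b))"
proof -
  have shift: "exp (v / 2) * mvn_density \<mu> v (w + (s * v) *\<^sub>R b) = mvn_density \<mu> v w * exp (- (s * ((w - \<mu>) \<bullet> b)))"
    if "b \<in> Basis" "s\<^sup>2 = 1" for b s
  proof -
    have "(norm (w + (s * v) *\<^sub>R b - \<mu>))\<^sup>2 = (norm ((w - \<mu>) + (s * v) *\<^sub>R b))\<^sup>2"
      by (simp add: algebra_simps)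
    also have "\<dots> = (norm (w - \<mu>))\<^sup>2 + 2 * v * (s * ((w - \<mu>) \<bullet> b)) + s\<^sup>2 * v\<^sup>2 * (b \<bullet> b)"
      unfolding power2_norm_eq_inner
      by (simp add: inner_add_left inner_add_right inner_commute power2_eq_square)
    also have "\<dots> = (norm (w - \<mu>))\<^sup>2 + 2 * v * (s * ((w - \<mu>) \<bullet> b)) + v\<^sup>2"
      using that by (simp add: inner_Basis)
    finally have "v / 2 + - (norm (w + (s * v) *\<^sub>R b - \<mu>))\<^sup>2 / (2 * v)
        = - (norm (w - \<mu>))\<^sup>2 / (2 * v) + - (s * ((w - \<mu>) \<bullet> b))"
      using v by (simp add: field_simps power2_eq_square)
    from arg_cong[OF this, of exp] show ?thesis
      unfolding mvn_density_def exp_add by simp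
  qed
  have "(norm (w - \<mu>))\<^sup>2 = (\<Sum>b\<in>Basis. ((w - \<mu>) \<bullet> b)\<^sup>2)"
    unfolding power2_norm_eq_inner by (subst euclidean_inner) (simp add: power2_eq_square)
  then have "mvn_density \<mu> v w * (norm (w - \<mu>))\<^sup>2 = (\<Sum>b\<in>Basis. mvn_density \<mu> v w * ((w - \<mu>) \<bullet> b)\<^sup>2)"
    by (simp add: sum_distrib_left)
  also have "\<dots> \<le> (\<Sum>b\<in>Basis. mvn_density \<mu> v w * (2 * (exp ((w - \<mu>) \<bullet> b) + exp (- ((w - \<mu>) \<bullet> b)))))"
    by (intro sum_mono mult_left_mono sum_exp_ge_square less_imp_le[OF mvn_density_pos] v)
  also have "\<dots> = (\<Sum>b\<in>Basis. 2 * (exp (v / 2) * mvn_density \<mu> v (w + v *\<^sub>R b)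
      + exp (v / 2) * mvn_density \<mu> v (w - v *\<^sub>R b)))"
    using shift[where s = 1] shift[where s = "-1"]
    by (intro sum.cong refl) (simp add: algebra_simps)
  also have "\<dots> = 2 * exp (v / 2) * (\<Sum>b\<in>Basis. mvn_density \<mu> v (w + v *\<^sub>R b) + mvn_density \<mu> v (w - v *\<^sub>R b))"
    by (simp add: sum_distrib_left algebra_simps)
  finally show ?thesis .
qed

text \<open>
  A posterior that exists at every observation has second moments, even for an improper prior: the
  second moment at \<open>w\<close> is bounded by marginals at shifted observations, which are finite. Without this
  every estimator could have infinite posterior loss, and a Bayes rule would not determine the
  posterior mean.
\<close>

lemma posterior_second_moment_finite:
  fixes \<pi> :: "'a::euclidean_space \<Rightarrow> real"
  assumes v: "0 < v" and \<pi>: "prior_density \<pi>"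
    and prob: "\<And>w. prob_space (posterior (\<lambda>\<mu>. mvn_density \<mu> v) \<pi> w)"
  shows "(\<integral>\<^sup>+\<mu>. squared_error \<mu> w \<partial>posterior (\<lambda>\<mu>. mvn_density \<mu> v) \<pi> w) < \<infinity>"
proof -
  have [measurable]: "\<pi> \<in> borel_measurable borel" and \<pi>0: "0 \<le> \<pi> \<mu>" for \<mu>
    using \<pi> by (auto simp: prior_density_def)
  let ?m = "marginal (\<lambda>\<mu>. mvn_density \<mu> v) \<pi>"
  have marg: "?m w \<noteq> 0" "?m w < \<infinity>" for w
    using prob[of w] by (subst (asm) prob_space_posterior_iff; simp add: less_top)+
  note pos = less_imp_le[OF mvn_density_pos[OF v]]
  define c where "c = 2 * exp (v / 2)"
  have "ennreal (mvn_density \<mu> v w * \<pi> \<mu>) * squared_error \<mu> w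
      \<le> ennreal c * (\<Sum>b\<in>Basis. ennreal (mvn_density \<mu> v (w + v *\<^sub>R b) * \<pi> \<mu>)
         + ennreal (mvn_density \<mu> v (w - v *\<^sub>R b) * \<pi> \<mu>))" for \<mu>
  proof -
    have "mvn_density \<mu> v w * \<pi> \<mu> * (norm (w - \<mu>))\<^sup>2
        \<le> c * (\<Sum>b\<in>Basis. mvn_density \<mu> v (w + v *\<^sub>R b) * \<pi> \<mu> + mvn_density \<mu> v (w - v *\<^sub>R b) * \<pi> \<mu>)"
      using mult_right_mono[OF mvn_squared_error_le_shifts[OF v, of \<mu> w] \<pi>0[of \<mu>]]
      by (simp add: c_def sum_distrib_left sum_distrib_right algebra_simps)
    moreover have "ennreal c * (\<Sum>b\<in>Basis. ennreal (mvn_density \<mu> v (w + v *\<^sub>R b) * \<pi> \<mu>)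
         + ennreal (mvn_density \<mu> v (w - v *\<^sub>R b) * \<pi> \<mu>))
       = ennreal (c * (\<Sum>b\<in>Basis. mvn_density \<mu> v (w + v *\<^sub>R b) * \<pi> \<mu> + mvn_density \<mu> v (w - v *\<^sub>R b) * \<pi> \<mu>))"
      by (subst ennreal_mult) (simp_all add: pos \<pi>0 sum_nonneg c_def sum_ennreal[symmetric] del: sum_ennreal)
    moreover have "ennreal (mvn_density \<mu> v w * \<pi> \<mu>) * squared_error \<mu> w
        = ennreal (mvn_density \<mu> v w * \<pi> \<mu> * (norm (w - \<mu>))\<^sup>2)"
      unfolding squared_error_def by (rule ennreal_mult[symmetric]) (simp_all add: pos \<pi>0)
    ultimately show ?thesis by (simp only: ennreal_leI)
  qed
  then have "(\<integral>\<^sup>+\<mu>. ennreal (mvn_density \<mu> v w * \<pi> \<mu>) * squared_error \<mu> w \<partial>lborel)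
      \<le> (\<integral>\<^sup>+\<mu>. ennreal c * (\<Sum>b\<in>Basis. ennreal (mvn_density \<mu> v (w + v *\<^sub>R b) * \<pi> \<mu>)
         + ennreal (mvn_density \<mu> v (w - v *\<^sub>R b) * \<pi> \<mu>)) \<partial>lborel)"
    by (intro nn_integral_mono) auto
  also have "\<dots> = ennreal c * (\<Sum>b\<in>Basis. ?m (w + v *\<^sub>R b) + ?m (w - v *\<^sub>R b))"
    by (simp add: nn_integral_cmult nn_integral_sum nn_integral_add marginal_def)
  also have "\<dots> < \<infinity>"
    using marg by (simp add: ennreal_mult_less_top)
  finally have "(\<integral>\<^sup>+\<mu>. ennreal (mvn_density \<mu> v w * \<pi> \<mu>) * squared_error \<mu> w \<partial>lborel) < \<infinity>" .
  then show ?thesis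
    using marg[of w]
    by (subst nn_integral_posterior) (simp_all add: less_top[symmetric] ennreal_divide_eq_top_iff)
qed

section \<open>Separating the model into two independent coordinates\<close>

lemma coord_inverse:
  assumes "1 + r \<noteq> 0"
  shows "coord1 r (u + w, w - r *\<^sub>R u) = u" "coord2 r (u + w, w - r *\<^sub>R u) = w"
proof -
  have "u + w - (w - r *\<^sub>R u) = (1 + r) *\<^sub>R u" "r *\<^sub>R (u + w) + (w - r *\<^sub>R u) = (1 + r) *\<^sub>R w"
    by (simp_all add: algebra_simps)
  then show "coord1 r (u + w, w - r *\<^sub>R u) = u" "coord2 r (u + w, w - r *\<^sub>R u) = w"
    using assms by (simp_all add: coord1_def coord2_def)
qed

lemma pair_eq_coords:
  assumes "1 + r \<noteq> 0"
  shows "z = (coord1 r z + coord2 r z, coord2 r z - r *\<^sub>R coord1 r z)"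
proof (rule prod_eqI)
  have "coord1 r z + coord2 r z = ((1 + r) *\<^sub>R fst z) /\<^sub>R (1 + r)"
    unfolding coord1_def coord2_def scaleR_add_right[symmetric] by (simp add: algebra_simps)
  then show "fst z = fst (coord1 r z + coord2 r z, coord2 r z - r *\<^sub>R coord1 r z)"
    using assms by simp
  have "coord2 r z - r *\<^sub>R coord1 r z = ((1 + r) *\<^sub>R snd z) /\<^sub>R (1 + r)"
    unfolding coord1_def coord2_def scaleR_left_commute[of r] scaleR_diff_right[symmetric]
    by (simp add: algebra_simps)
  then show "snd z = snd (coord1 r z + coord2 r z, coord2 r z - r *\<^sub>R coord1 r z)"
    using assms by simp
qed

lemma coord_measurable [measurable]:
  "coord1 r \<in> borel_measurable (borel :: ('a::euclidean_space \<times> 'a) measure)"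
  "coord2 r \<in> borel_measurable (borel :: ('a::euclidean_space \<times> 'a) measure)"
  unfolding coord1_def[abs_def] coord2_def[abs_def]
  by (intro borel_measurable_continuous_onI continuous_intros)+

text \<open>
  The linear map \<open>(u, w) \<mapsto> (u + w, w - r u)\<close> is inverse to the two coordinates. Scaling the second
  component for fixed first component, exchanging the integrals and then translating the first
  component gives its Jacobian without a determinant on the product space.
\<close>

lemma nn_integral_coords:
  fixes F :: "'a::euclidean_space \<times> 'a \<Rightarrow> ennreal"
  assumes [measurable]: "F \<in> borel_measurable borel" and r: "0 < 1 + r"
  shows "(\<integral>\<^sup>+z. F z \<partial>lborel)
    = ennreal ((1 + r) ^ DIM('a)) * (\<integral>\<^sup>+u. \<integral>\<^sup>+w. F (u + w, w - r *\<^sub>R u) \<partial>lborel \<partial>lborel)"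
proof -
  have "F \<in> borel_measurable (lborel \<Otimes>\<^sub>M lborel)"
    by (simp add: lborel_prod)
  from lborel.nn_integral_fst[OF this]
  have "(\<integral>\<^sup>+z. F z \<partial>lborel) = (\<integral>\<^sup>+x. \<integral>\<^sup>+y. F (x, y) \<partial>lborel \<partial>lborel)"
    by (simp add: lborel_prod)
  also have "\<dots> = (\<integral>\<^sup>+x. ennreal ((1 + r) ^ DIM('a)) * (\<integral>\<^sup>+u. F (x, x + (- (1 + r)) *\<^sub>R u) \<partial>lborel) \<partial>lborel)"
  proof (rule nn_integral_cong)
    fix x :: 'a
    have "ennreal (\<bar>- (1 + r)\<bar> ^ DIM('a)) = ennreal ((1 + r) ^ DIM('a))" using r by (simp add: add.commute)
    then show "(\<integral>\<^sup>+y. F (x, y) \<partial>lborel)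
        = ennreal ((1 + r) ^ DIM('a)) * (\<integral>\<^sup>+u. F (x, x + (- (1 + r)) *\<^sub>R u) \<partial>lborel)"
      using r nn_integral_lborel_affine[where f = "\<lambda>y. F (x, y)" and c = "- (1 + r)" and t = x] by simp
  qed
  also have "\<dots> = ennreal ((1 + r) ^ DIM('a)) * (\<integral>\<^sup>+x. \<integral>\<^sup>+u. F (x, x + (- (1 + r)) *\<^sub>R u) \<partial>lborel \<partial>lborel)"
    by (subst nn_integral_cmult) simp_all
  also have "(\<integral>\<^sup>+x. \<integral>\<^sup>+u. F (x, x + (- (1 + r)) *\<^sub>R u) \<partial>lborel \<partial>lborel)
      = (\<integral>\<^sup>+u. \<integral>\<^sup>+x. F (x, x + (- (1 + r)) *\<^sub>R u) \<partial>lborel \<partial>lborel)"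
    by (subst lborel_pair.Fubini') simp_all
  also have "\<dots> = (\<integral>\<^sup>+u. \<integral>\<^sup>+w. F (u + w, w - r *\<^sub>R u) \<partial>lborel \<partial>lborel)"
  proof (rule nn_integral_cong)
    fix u :: 'a
    have shear: "w - r *\<^sub>R u = u + w + (- (1 + r)) *\<^sub>R u" for w
      by (simp add: algebra_simps)
    show "(\<integral>\<^sup>+x. F (x, x + (- (1 + r)) *\<^sub>R u) \<partial>lborel) = (\<integral>\<^sup>+w. F (u + w, w - r *\<^sub>R u) \<partial>lborel)"
      unfolding shear by (subst nn_integral_lborel_affine[where c = 1 and t = u]) simp_all
  qed
  finally show ?thesis .
qed

lemma X_density_commute: "X_density v\<^sub>1 v\<^sub>2 \<theta> x = X_density v\<^sub>1 v\<^sub>2 x \<theta>"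
  unfolding X_density_def by (metis mvn_density_commute)

lemma X_density_measurable [measurable]:
  "(\<lambda>\<theta>. X_density v\<^sub>1 v\<^sub>2 \<theta> x) \<in> borel_measurable (borel :: ('a::euclidean_space \<times> 'a) measure)"
  "X_density v\<^sub>1 v\<^sub>2 \<theta> \<in> borel_measurable (borel :: ('a::euclidean_space \<times> 'a) measure)"
proof -
  have [measurable]: "fst \<in> borel_measurable (borel :: ('a \<times> 'a) measure)"
    "snd \<in> borel_measurable (borel :: ('a \<times> 'a) measure)"
    by (intro borel_measurable_continuous_onI continuous_intros)+
  show "(\<lambda>\<theta>. X_density v\<^sub>1 v\<^sub>2 \<theta> x) \<in> borel_measurable (borel :: ('a \<times> 'a) measure)"
    "X_density v\<^sub>1 v\<^sub>2 \<theta> \<in> borel_measurable (borel :: ('a \<times> 'a) measure)"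
    unfolding X_density_def[abs_def] by measurable
qed

text \<open>
  In the new coordinates the likelihood factors: with \<open>a\<close> and \<open>b\<close> the errors of the two coordinates, the
  cross terms \<open>a \<bullet> b\<close> of the two exponents cancel because \<open>r\<close> is the ratio of the variances.
\<close>

lemma X_density_coords:
  fixes u w :: "'a::euclidean_space"
  assumes "0 < v\<^sub>1" and r: "0 < r"
  shows "(1 + r) ^ DIM('a) * X_density v\<^sub>1 (r * v\<^sub>1) (u + w, w - r *\<^sub>R u) x
    = mvn_density u (v\<^sub>1 / (1 + r)) (coord1 r x) * mvn_density w (r * v\<^sub>1 / (1 + r)) (coord2 r x)"
proof -
  define a b where "a = coord1 r x - u" and "b = coord2 r x - w"
  have x: "x = (coord1 r x + coord2 r x, coord2 r x - r *\<^sub>R coord1 r x)"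
    using r by (intro pair_eq_coords) simp
  have fx: "fst x - (u + w) = a + b" and sx: "snd x - (w - r *\<^sub>R u) = b - r *\<^sub>R a"
    using arg_cong[OF x, of fst] arg_cong[OF x, of snd]
    by (simp_all add: a_def b_def algebra_simps)
  have e: "- (norm (a + b))\<^sup>2 / (2 * v\<^sub>1) + - (norm (b - r *\<^sub>R a))\<^sup>2 / (2 * (r * v\<^sub>1))
     = - (norm a)\<^sup>2 / (2 * (v\<^sub>1 / (1 + r))) + - (norm b)\<^sup>2 / (2 * (r * v\<^sub>1 / (1 + r)))"
  proof -
    have n: "(norm (a + b))\<^sup>2 = (norm a)\<^sup>2 + (norm b)\<^sup>2 + 2 * (a \<bullet> b)"
      "(norm (b - r *\<^sub>R a))\<^sup>2 = (norm b)\<^sup>2 + r\<^sup>2 * (norm a)\<^sup>2 - 2 * r * (a \<bullet> b)"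
      unfolding power2_norm_eq_inner
      by (simp_all add: algebra_simps inner_commute power2_eq_square)
    show ?thesis
      unfolding n using assms by (simp add: field_simps power2_eq_square)
  qed
  have "sqrt (2 * pi * v\<^sub>1) * sqrt (2 * pi * (r * v\<^sub>1))
     = (1 + r) * (sqrt (2 * pi * (v\<^sub>1 / (1 + r))) * sqrt (2 * pi * (r * v\<^sub>1 / (1 + r))))"
  proof -
    have k: "k\<^sup>2 * (2 * pi * (a / k) * (2 * pi * (b / k))) = (2 * pi * a) * (2 * pi * b)"
      if "k \<noteq> 0" for k a b :: real
      using that by (simp add: field_simps power2_eq_square)
    have "(1 + r) * (sqrt (2 * pi * (v\<^sub>1 / (1 + r))) * sqrt (2 * pi * (r * v\<^sub>1 / (1 + r))))
      = sqrt ((1 + r)\<^sup>2) * (sqrt (2 * pi * (v\<^sub>1 / (1 + r))) * sqrt (2 * pi * (r * v\<^sub>1 / (1 + r))))"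
      using r by simp
    also have "\<dots> = sqrt ((2 * pi * v\<^sub>1) * (2 * pi * (r * v\<^sub>1)))"
      unfolding real_sqrt_mult[symmetric] using r
      by (intro arg_cong[where f = sqrt] k) simp
    finally show ?thesis by (simp only: real_sqrt_mult)
  qed
  then have c: "sqrt (2 * pi * v\<^sub>1) ^ DIM('a) * sqrt (2 * pi * (r * v\<^sub>1)) ^ DIM('a)
     = (1 + r) ^ DIM('a) * (sqrt (2 * pi * (v\<^sub>1 / (1 + r))) ^ DIM('a) * sqrt (2 * pi * (r * v\<^sub>1 / (1 + r))) ^ DIM('a))"
    by (simp only: power_mult_distrib[symmetric])
  have "(1 + r) ^ DIM('a) \<noteq> 0" using r by simp
  then show ?thesis
    unfolding X_density_def mvn_density_def fst_conv snd_conv fx sx a_def[symmetric] b_def[symmetric]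
      times_divide_times_eq exp_add[symmetric] e c
    by simp
qed

lemma nn_integral_X_density_coords:
  fixes F :: "'a::euclidean_space \<times> 'a \<Rightarrow> ennreal"
  assumes v: "0 < v\<^sub>1" and r: "0 < r" and [measurable]: "F \<in> borel_measurable borel"
  shows "(\<integral>\<^sup>+z. ennreal (X_density v\<^sub>1 (r * v\<^sub>1) z x) * F z \<partial>lborel)
    = (\<integral>\<^sup>+u. ennreal (mvn_density u (v\<^sub>1 / (1 + r)) (coord1 r x)) *
        (\<integral>\<^sup>+w. ennreal (mvn_density w (r * v\<^sub>1 / (1 + r)) (coord2 r x)) * F (u + w, w - r *\<^sub>R u) \<partial>lborel) \<partial>lborel)"
proof -
  have pos: "0 \<le> mvn_density u (v\<^sub>1 / (1 + r)) (coord1 r x)" "0 \<le> mvn_density u (r * v\<^sub>1 / (1 + r)) (coord2 r x)"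
    "0 \<le> (1 + r) ^ DIM('a)" for u
    using v r by (auto intro!: less_imp_le[OF mvn_density_pos])
  have Xpos: "0 \<le> X_density v\<^sub>1 (r * v\<^sub>1) z x" for z
    using v r by (auto simp: X_density_def intro!: mult_nonneg_nonneg less_imp_le[OF mvn_density_pos])
  have "ennreal ((1 + r) ^ DIM('a)) * (ennreal (X_density v\<^sub>1 (r * v\<^sub>1) (u + w, w - r *\<^sub>R u) x) * c)
     = ennreal (mvn_density u (v\<^sub>1 / (1 + r)) (coord1 r x)) * (ennreal (mvn_density w (r * v\<^sub>1 / (1 + r)) (coord2 r x)) * c)"
    for u w c
    unfolding mult.assoc[symmetric] ennreal_mult[OF pos(1) pos(2), symmetric] ennreal_mult[OF pos(3) Xpos, symmetric]
    by (simp only: X_density_coords[OF v r])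
  then show ?thesis
    using r by (subst nn_integral_coords[where r = r]) (simp_all add: nn_integral_cmult[symmetric])
qed


section \<open>Posterior and risk in the two coordinates\<close>

lemma prior_\<theta>_eq: "prior_\<theta> \<pi>\<^sub>1 A r = (\<lambda>\<theta>. prior_\<mu>1 \<pi>\<^sub>1 A r (coord1 r \<theta>))"
  by (simp add: fun_eq_iff prior_\<theta>_def prior_\<mu>1_def)

lemma parallel_axis_translate:
  assumes "parallel_axis M T m V"
  shows "parallel_axis M (\<lambda>\<omega>. c + T \<omega>) (c + m) V"
proof -
  have "squared_error (c + t) y = squared_error t (y - c)" for t y
    by (simp add: squared_error_def algebra_simps)
  moreover have "(\<lambda>\<omega>. c + T \<omega>) \<in> borel_measurable M"
    using parallel_axisD(1)[OF assms] by simp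
  ultimately show ?thesis using assms by (simp add: parallel_axis_def)
qed

text \<open>
  With a flat prior on the second coordinate, that coordinate is a posteriori normal around its
  observed value and independent of the first, whose posterior is that of the one-sample problem.
\<close>

lemma nn_integral_likelihood_prior:
  fixes F :: "'a::euclidean_space \<times> 'a \<Rightarrow> ennreal"
  assumes v: "0 < v\<^sub>1" and r: "0 < r" and \<pi>: "prior_density \<pi>" and [measurable]: "F \<in> borel_measurable borel"
  shows "(\<integral>\<^sup>+\<theta>. ennreal (X_density v\<^sub>1 (r * v\<^sub>1) \<theta> x * \<pi> (coord1 r \<theta>)) * F \<theta> \<partial>lborel)
    = (\<integral>\<^sup>+u. ennreal (mvn_density u (v\<^sub>1 / (1 + r)) (coord1 r x) * \<pi> u) *
        (\<integral>\<^sup>+w. F (u + w, w - r *\<^sub>R u) \<partial>density lborel (\<lambda>w. ennreal (mvn_density (coord2 r x) (r * v\<^sub>1 / (1 + r)) w))) \<partial>lborel)"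
proof -
  have [measurable]: "\<pi> \<in> borel_measurable borel" and \<pi>0: "0 \<le> \<pi> \<mu>" for \<mu>
    using \<pi> by (auto simp: prior_density_def)
  have Xpos: "0 \<le> X_density v\<^sub>1 (r * v\<^sub>1) z x" for z
    using v r by (auto simp: X_density_def intro!: mult_nonneg_nonneg less_imp_le[OF mvn_density_pos])
  have pos: "0 \<le> mvn_density u (v\<^sub>1 / (1 + r)) (coord1 r x)" for u
    using v r by (auto intro!: less_imp_le[OF mvn_density_pos])
  have "(\<integral>\<^sup>+\<theta>. ennreal (X_density v\<^sub>1 (r * v\<^sub>1) \<theta> x * \<pi> (coord1 r \<theta>)) * F \<theta> \<partial>lborel)
    = (\<integral>\<^sup>+\<theta>. ennreal (X_density v\<^sub>1 (r * v\<^sub>1) \<theta> x) * (ennreal (\<pi> (coord1 r \<theta>)) * F \<theta>) \<partial>lborel)"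
    by (simp add: ennreal_mult[OF Xpos \<pi>0] mult.assoc)
  also have "\<dots> = (\<integral>\<^sup>+u. ennreal (mvn_density u (v\<^sub>1 / (1 + r)) (coord1 r x)) *
        (\<integral>\<^sup>+w. ennreal (mvn_density w (r * v\<^sub>1 / (1 + r)) (coord2 r x)) *
           (ennreal (\<pi> u) * F (u + w, w - r *\<^sub>R u)) \<partial>lborel) \<partial>lborel)"
    using r by (subst nn_integral_X_density_coords[OF v r]) (simp_all add: coord_inverse)
  also have "\<dots> = (\<integral>\<^sup>+u. ennreal (mvn_density u (v\<^sub>1 / (1 + r)) (coord1 r x) * \<pi> u) *
        (\<integral>\<^sup>+w. F (u + w, w - r *\<^sub>R u) \<partial>density lborel (\<lambda>w. ennreal (mvn_density (coord2 r x) (r * v\<^sub>1 / (1 + r)) w))) \<partial>lborel)"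
  proof (rule nn_integral_cong)
    fix u :: 'a
    have "(\<integral>\<^sup>+w. ennreal (mvn_density w (r * v\<^sub>1 / (1 + r)) (coord2 r x)) * (ennreal (\<pi> u) * F (u + w, w - r *\<^sub>R u)) \<partial>lborel)
        = (\<integral>\<^sup>+w. ennreal (\<pi> u) * (ennreal (mvn_density (coord2 r x) (r * v\<^sub>1 / (1 + r)) w) * F (u + w, w - r *\<^sub>R u)) \<partial>lborel)"
      by (subst mvn_density_commute) (simp only: mult.left_commute)
    also have "\<dots> = ennreal (\<pi> u) * (\<integral>\<^sup>+w. F (u + w, w - r *\<^sub>R u)
        \<partial>density lborel (\<lambda>w. ennreal (mvn_density (coord2 r x) (r * v\<^sub>1 / (1 + r)) w)))"
      by (simp add: nn_integral_cmult nn_integral_density)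
    finally show "ennreal (mvn_density u (v\<^sub>1 / (1 + r)) (coord1 r x)) *
        (\<integral>\<^sup>+w. ennreal (mvn_density w (r * v\<^sub>1 / (1 + r)) (coord2 r x)) *
           (ennreal (\<pi> u) * F (u + w, w - r *\<^sub>R u)) \<partial>lborel)
       = ennreal (mvn_density u (v\<^sub>1 / (1 + r)) (coord1 r x) * \<pi> u) *
        (\<integral>\<^sup>+w. F (u + w, w - r *\<^sub>R u) \<partial>density lborel (\<lambda>w. ennreal (mvn_density (coord2 r x) (r * v\<^sub>1 / (1 + r)) w)))"
      by (simp only: ennreal_mult[OF pos \<pi>0] mult.assoc)
  qed
  finally show ?thesis .
qed

lemma marginal_coord1:
  fixes \<pi> :: "'a::euclidean_space \<Rightarrow> real"
  assumes v: "0 < v\<^sub>1" and r: "0 < r" and \<pi>: "prior_density \<pi>"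
  shows "marginal (X_density v\<^sub>1 (r * v\<^sub>1)) (\<lambda>\<theta>. \<pi> (coord1 r \<theta>)) x
    = marginal (\<lambda>\<mu>. mvn_density \<mu> (v\<^sub>1 / (1 + r))) \<pi> (coord1 r x)"
proof -
  have "0 < r * v\<^sub>1 / (1 + r)" using v r by simp
  then show ?thesis
    using nn_integral_likelihood_prior[OF assms, of "\<lambda>_. 1" x]
      prob_space.emeasure_space_1[OF prob_space_mvn[of "r * v\<^sub>1 / (1 + r)" "coord2 r x"]]
    by (simp add: marginal_def)
qed

text \<open>
  \<open>\<theta>\<^sub>1 = \<mu>\<^sub>1 + \<mu>\<^sub>2\<close> is a posteriori a sum of independent vectors with means \<open>m\<close> and \<open>W\<^sub>2\<close>; the
  parallel axis identity is applied once for each.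
\<close>

lemma posterior_mean_\<theta>\<^sub>1:
  fixes \<pi> :: "'a::euclidean_space \<Rightarrow> real"
  assumes v: "0 < v\<^sub>1" and r: "0 < r" and \<pi>: "prior_density \<pi>"
    and prob: "prob_space (posterior (\<lambda>\<mu>. mvn_density \<mu> (v\<^sub>1 / (1 + r))) \<pi> (coord1 r x))"
    and T: "parallel_axis (posterior (\<lambda>\<mu>. mvn_density \<mu> (v\<^sub>1 / (1 + r))) \<pi> (coord1 r x)) (\<lambda>\<mu>. \<mu>) m V"
  shows "\<exists>V. parallel_axis (posterior (X_density v\<^sub>1 (r * v\<^sub>1)) (\<lambda>\<theta>. \<pi> (coord1 r \<theta>)) x) fst (m + coord2 r x) V"
proof -
  let ?post1 = "posterior (\<lambda>\<mu>. mvn_density \<mu> (v\<^sub>1 / (1 + r))) \<pi> (coord1 r x)"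
  let ?post2 = "posterior (X_density v\<^sub>1 (r * v\<^sub>1)) (\<lambda>\<theta>. \<pi> (coord1 r \<theta>)) x"
  have [measurable]: "\<pi> \<in> borel_measurable borel" and \<pi>0: "0 \<le> \<pi> \<mu>" for \<mu>
    using \<pi> by (auto simp: prior_density_def)
  have fst_m[measurable]: "fst \<in> borel_measurable (borel :: ('a \<times> 'a) measure)"
    by (intro borel_measurable_continuous_onI continuous_intros)
  interpret prob_space ?post1 by fact
  have "0 < r * v\<^sub>1 / (1 + r)" using v r by simp
  from parallel_axis_mvn[OF this] obtain K where
    K: "parallel_axis (density lborel (\<lambda>w. ennreal (mvn_density (coord2 r x) (r * v\<^sub>1 / (1 + r)) w))) (\<lambda>w. w) (coord2 r x) K"
    by blast
  note K_u = parallel_axisD(3)[OF parallel_axis_translate[OF K]]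
  have T_c: "parallel_axis ?post1 (\<lambda>u. u + coord2 r x) (m + coord2 r x) V"
    using parallel_axis_translate[OF T, of "coord2 r x"] by (simp add: add.commute)
  have "(\<integral>\<^sup>+\<theta>. squared_error (fst \<theta>) y \<partial>?post2) = squared_error (m + coord2 r x) y + ennreal (V + K)" for y
  proof -
    have "(\<integral>\<^sup>+\<theta>. squared_error (fst \<theta>) y \<partial>?post2)
       = (\<integral>\<^sup>+u. squared_error (u + coord2 r x) y + ennreal K \<partial>?post1)"
      by (simp add: nn_integral_posterior nn_integral_likelihood_prior[OF v r \<pi>] marginal_coord1[OF v r \<pi>] K_u)
    also have "\<dots> = squared_error (m + coord2 r x) y + ennreal V + ennreal K"
      using parallel_axisD(1)[OF T_c]
      by (subst nn_integral_add) (simp_all add: parallel_axisD(3)[OF T_c] emeasure_space_1)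
    finally show ?thesis
      using parallel_axisD(2)[OF K] parallel_axisD(2)[OF T] by (simp add: add.assoc)
  qed
  moreover have "fst \<in> borel_measurable ?post2"
    using fst_m by (simp add: posterior_def)
  ultimately show ?thesis
    using parallel_axisD(2)[OF K] parallel_axisD(2)[OF T]
    unfolding parallel_axis_def by (intro exI[of _ "V + K"]) simp
qed

text \<open>
  Given \<open>W\<^sub>1\<close>, averaging the squared error over the independent \<open>W\<^sub>2\<close> leaves the squared error of
  \<open>\<psi>(W\<^sub>1)\<close> for \<open>\<mu>\<^sub>1\<close> plus the variance of \<open>W\<^sub>2\<close>. The identity also holds if the risk is infinite.
\<close>

lemma predictive_risk_eq:
  fixes \<psi> :: "'a::euclidean_space \<Rightarrow> 'a" and \<theta> :: "'a \<times> 'a"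
  assumes v: "0 < v\<^sub>1" and r: "0 < r" and [measurable]: "\<psi> \<in> borel_measurable borel"
    and loss: "\<And>x. predictive_loss v\<^sub>Y \<theta> (d x) = ennreal (1 / (2 * v\<^sub>Y)) * squared_error (fst \<theta>) (\<psi> (coord1 r x) + coord2 r x)"
    and K: "parallel_axis (density lborel (\<lambda>w. ennreal (mvn_density (coord2 r \<theta>) (r * v\<^sub>1 / (1 + r)) w))) (\<lambda>w. w) (coord2 r \<theta>) K"
  shows "risk (X_density v\<^sub>1 (r * v\<^sub>1)) (predictive_loss v\<^sub>Y) d \<theta>
    = ennreal (1 / (2 * v\<^sub>Y)) * (risk (\<lambda>\<mu>. mvn_density \<mu> (v\<^sub>1 / (1 + r))) squared_error \<psi> (coord1 r \<theta>) + ennreal K)"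
proof -
  have "0 < v\<^sub>1 / (1 + r)" using v r by simp
  note mass1 = nn_integral_mvn_density[OF this]
  have "\<theta> = (coord1 r \<theta> + coord2 r \<theta>, coord2 r \<theta> - r *\<^sub>R coord1 r \<theta>)"
    using r by (intro pair_eq_coords) simp
  then have \<theta>: "fst \<theta> = coord1 r \<theta> + coord2 r \<theta>" by (metis fst_conv)
  let ?F = "\<lambda>z. squared_error (fst \<theta>) (\<psi> (coord1 r z) + coord2 r z)"
  have inner: "(\<integral>\<^sup>+w. ennreal (mvn_density w (r * v\<^sub>1 / (1 + r)) (coord2 r \<theta>)) * squared_error (fst \<theta>) (\<psi> u + w) \<partial>lborel)
     = squared_error (coord1 r \<theta>) (\<psi> u) + ennreal K" for u
  proof -
    have "squared_error (fst \<theta>) (\<psi> u + w) = squared_error w (fst \<theta> - \<psi> u)" for w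
      by (simp add: squared_error_def norm_minus_commute algebra_simps)
    moreover have "squared_error (coord2 r \<theta>) (fst \<theta> - \<psi> u) = squared_error (coord1 r \<theta>) (\<psi> u)"
      unfolding \<theta> by (simp add: squared_error_def norm_minus_commute algebra_simps)
    ultimately show ?thesis
      using parallel_axisD(3)[OF K, of "fst \<theta> - \<psi> u"]
      by (simp add: nn_integral_density mvn_density_commute[of _ _ "coord2 r \<theta>"])
  qed
  have "risk (X_density v\<^sub>1 (r * v\<^sub>1)) (predictive_loss v\<^sub>Y) d \<theta>
      = (\<integral>\<^sup>+z. ennreal (1 / (2 * v\<^sub>Y)) * (ennreal (X_density v\<^sub>1 (r * v\<^sub>1) z \<theta>) * ?F z) \<partial>lborel)"
    unfolding risk_def loss
    by (simp add: nn_integral_density X_density_commute[of _ _ \<theta>] mult.left_commute)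
  also have "\<dots> = ennreal (1 / (2 * v\<^sub>Y)) * (\<integral>\<^sup>+z. ennreal (X_density v\<^sub>1 (r * v\<^sub>1) z \<theta>) * ?F z \<partial>lborel)"
    by (rule nn_integral_cmult) simp
  also have "(\<integral>\<^sup>+z. ennreal (X_density v\<^sub>1 (r * v\<^sub>1) z \<theta>) * ?F z \<partial>lborel)
      = (\<integral>\<^sup>+u. ennreal (mvn_density u (v\<^sub>1 / (1 + r)) (coord1 r \<theta>)) *
          (squared_error (coord1 r \<theta>) (\<psi> u) + ennreal K) \<partial>lborel)"
    using r by (subst nn_integral_X_density_coords[OF v r]) (simp_all add: coord_inverse inner)
  also have "\<dots> = (\<integral>\<^sup>+u. ennreal (mvn_density (coord1 r \<theta>) (v\<^sub>1 / (1 + r)) u) * squared_error (coord1 r \<theta>) (\<psi> u)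
        + ennreal K * ennreal (mvn_density (coord1 r \<theta>) (v\<^sub>1 / (1 + r)) u) \<partial>lborel)"
    by (simp add: mvn_density_commute[of _ _ "coord1 r \<theta>"] distrib_right mult.commute)
  also have "\<dots> = risk (\<lambda>\<mu>. mvn_density \<mu> (v\<^sub>1 / (1 + r))) squared_error \<psi> (coord1 r \<theta>) + ennreal K"
    by (simp add: risk_def nn_integral_density nn_integral_add nn_integral_cmult mass1)
  finally show ?thesis .
qed

theorem proposition4p1:
  fixes \<sigma>\<^sub>1 \<sigma>\<^sub>2 \<sigma>\<^sub>Y r :: real
    and A :: "(real ^ 'p) set"
    and \<pi>\<^sub>1 :: "real ^ 'p \<Rightarrow> real"
    and \<psi>\<^sub>0 \<psi>\<^sub>\<pi> :: "real ^ 'p \<Rightarrow> real ^ 'p"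
    and q\<^sub>\<pi> :: "(real ^ 'p) \<times> (real ^ 'p) \<Rightarrow> real ^ 'p \<Rightarrow> real"
  assumes "0 < \<sigma>\<^sub>1" and "0 < \<sigma>\<^sub>2" and "0 < \<sigma>\<^sub>Y"
    and "r = \<sigma>\<^sub>2\<^sup>2 / \<sigma>\<^sub>1\<^sup>2"
    and "prior_density (prior_\<mu>1 \<pi>\<^sub>1 A r)"
    and "\<forall>x. prob_space (posterior (X_density (\<sigma>\<^sub>1\<^sup>2) (\<sigma>\<^sub>2\<^sup>2)) (prior_\<theta> \<pi>\<^sub>1 A r) x)"
    and "bayes_rule (X_density (\<sigma>\<^sub>1\<^sup>2) (\<sigma>\<^sub>2\<^sup>2)) (predictive_loss (\<sigma>\<^sub>Y\<^sup>2)) probability_densities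
           (prior_\<theta> \<pi>\<^sub>1 A r) q\<^sub>\<pi>"
    and "bayes_rule (\<lambda>\<mu>. mvn_density \<mu> (\<sigma>\<^sub>1\<^sup>2 / (1 + r))) squared_error UNIV
           (prior_\<mu>1 \<pi>\<^sub>1 A r) \<psi>\<^sub>\<pi>"
    and "\<psi>\<^sub>0 \<in> borel_measurable borel"
  shows "dominates (X_density (\<sigma>\<^sub>1\<^sup>2) (\<sigma>\<^sub>2\<^sup>2)) (predictive_loss (\<sigma>\<^sub>Y\<^sup>2))
             {\<theta>. fst \<theta> - snd \<theta> \<in> A}
             q\<^sub>\<pi> (\<lambda>x. mvn_density (\<psi>\<^sub>0 (coord1 r x) + coord2 r x) (\<sigma>\<^sub>Y\<^sup>2))
         \<longleftrightarrow>
         dominates (\<lambda>\<mu>. mvn_density \<mu> (\<sigma>\<^sub>1\<^sup>2 / (1 + r))) squared_error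
             {\<mu>. (1 + r) *\<^sub>R \<mu> \<in> A}
             \<psi>\<^sub>\<pi> \<psi>\<^sub>0"
proof -
  let ?\<pi> = "prior_\<mu>1 \<pi>\<^sub>1 A r"
  let ?f\<^sub>1 = "\<lambda>\<mu> :: real ^ 'p. mvn_density \<mu> (\<sigma>\<^sub>1\<^sup>2 / (1 + r))"
  let ?post = "posterior (X_density (\<sigma>\<^sub>1\<^sup>2) (\<sigma>\<^sub>2\<^sup>2)) (prior_\<theta> \<pi>\<^sub>1 A r)"
  let ?post\<^sub>1 = "posterior ?f\<^sub>1 ?\<pi>"
  let ?plugin = "\<lambda>x. mvn_density (\<psi>\<^sub>0 (coord1 r x) + coord2 r x) (\<sigma>\<^sub>Y\<^sup>2)"
  have r: "0 < r" and v: "0 < \<sigma>\<^sub>1\<^sup>2" and vY: "0 < \<sigma>\<^sub>Y\<^sup>2" and \<sigma>\<^sub>2: "\<sigma>\<^sub>2\<^sup>2 = r * \<sigma>\<^sub>1\<^sup>2"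
    using assms(1-4) by auto
  have v': "0 < \<sigma>\<^sub>1\<^sup>2 / (1 + r)" using v r by simp
  note \<pi> = assms(5)
  have [measurable]: "?\<pi> \<in> borel_measurable borel" and \<pi>0: "0 \<le> ?\<pi> \<mu>" for \<mu>
    using \<pi> by (auto simp: prior_density_def)
  have prob: "prob_space (?post x)" for x using assms(6) by blast
  (* every w is the first coordinate of some x, and the two marginals agree there *)
  have prob\<^sub>1: "prob_space (?post\<^sub>1 w)" for w
  proof -
    have "coord1 r (w + 0, 0 - r *\<^sub>R w) = w" using r by (intro coord_inverse) simp
    then show ?thesis
      using prob[of "(w + 0, 0 - r *\<^sub>R w)"] unfolding \<sigma>\<^sub>2 prior_\<theta>_eq
      by (subst (asm) prob_space_posterior_iff, simp)
         (subst prob_space_posterior_iff, simp, simp add: marginal_coord1[OF v r \<pi>])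
  qed
  have mean\<^sub>1: "\<exists>V. parallel_axis (?post\<^sub>1 w) (\<lambda>\<mu>. \<mu>) (\<psi>\<^sub>\<pi> w) V"
    and \<psi>\<^sub>\<pi>_eq: "\<psi>\<^sub>\<pi> w = integral\<^sup>L (?post\<^sub>1 w) (\<lambda>\<mu>. \<mu>)" for w
  proof -
    obtain V where V: "parallel_axis (?post\<^sub>1 w) (\<lambda>\<mu>. \<mu>) (integral\<^sup>L (?post\<^sub>1 w) (\<lambda>\<mu>. \<mu>)) V"
      using parallel_axis_expectation[OF prob\<^sub>1 _ posterior_second_moment_finite[OF v' \<pi> prob\<^sub>1]]
      by (auto simp: posterior_def)
    have "\<psi>\<^sub>\<pi> w = integral\<^sup>L (?post\<^sub>1 w) (\<lambda>\<mu>. \<mu>)"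
      using assms(8) by (intro squared_error_minimizer_unique[OF V]) (auto simp: bayes_rule_def)
    with V show "\<exists>V. parallel_axis (?post\<^sub>1 w) (\<lambda>\<mu>. \<mu>) (\<psi>\<^sub>\<pi> w) V"
      and "\<psi>\<^sub>\<pi> w = integral\<^sup>L (?post\<^sub>1 w) (\<lambda>\<mu>. \<mu>)" by auto
  qed
  have \<psi>\<^sub>\<pi>_meas: "\<psi>\<^sub>\<pi> \<in> borel_measurable borel"
  proof -
    have "(\<lambda>w. integral\<^sup>L (?post\<^sub>1 w) (\<lambda>\<mu>. \<mu>)) \<in> borel_measurable borel"
      by (intro posterior_mean_measurable prob\<^sub>1) (simp_all add: \<pi>0 less_imp_le[OF mvn_density_pos[OF v']])
    then show ?thesis by (simp add: \<psi>\<^sub>\<pi>_eq[symmetric])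
  qed
  have loss\<^sub>\<pi>: "predictive_loss (\<sigma>\<^sub>Y\<^sup>2) \<theta> (q\<^sub>\<pi> x)
      = ennreal (1 / (2 * \<sigma>\<^sub>Y\<^sup>2)) * squared_error (fst \<theta>) (\<psi>\<^sub>\<pi> (coord1 r x) + coord2 r x)" for \<theta> x
  proof -
    obtain V where V: "parallel_axis (?post x) fst (\<psi>\<^sub>\<pi> (coord1 r x) + coord2 r x) V"
      using mean\<^sub>1[of "coord1 r x"] posterior_mean_\<theta>\<^sub>1[OF v r \<pi> prob\<^sub>1]
      unfolding \<sigma>\<^sub>2 prior_\<theta>_eq by blast
    show ?thesis
      using assms(7) unfolding predictive_loss_def bayes_rule_def
      by (intro average_reverse_KL_minimizer[OF prob V vY]) blast+
  qed
  have loss\<^sub>0: "predictive_loss (\<sigma>\<^sub>Y\<^sup>2) \<theta> (?plugin x)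
      = ennreal (1 / (2 * \<sigma>\<^sub>Y\<^sup>2)) * squared_error (fst \<theta>) (\<psi>\<^sub>0 (coord1 r x) + coord2 r x)" for \<theta> x
    by (simp add: predictive_loss_def reverse_KL_mvn[OF vY])
  have le_iff: "risk (X_density (\<sigma>\<^sub>1\<^sup>2) (\<sigma>\<^sub>2\<^sup>2)) (predictive_loss (\<sigma>\<^sub>Y\<^sup>2)) q\<^sub>\<pi> \<theta>
        \<le> risk (X_density (\<sigma>\<^sub>1\<^sup>2) (\<sigma>\<^sub>2\<^sup>2)) (predictive_loss (\<sigma>\<^sub>Y\<^sup>2)) ?plugin \<theta>
      \<longleftrightarrow> risk ?f\<^sub>1 squared_error \<psi>\<^sub>\<pi> (coord1 r \<theta>) \<le> risk ?f\<^sub>1 squared_error \<psi>\<^sub>0 (coord1 r \<theta>)" (is ?le)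
    and less_iff: "risk (X_density (\<sigma>\<^sub>1\<^sup>2) (\<sigma>\<^sub>2\<^sup>2)) (predictive_loss (\<sigma>\<^sub>Y\<^sup>2)) q\<^sub>\<pi> \<theta>
        < risk (X_density (\<sigma>\<^sub>1\<^sup>2) (\<sigma>\<^sub>2\<^sup>2)) (predictive_loss (\<sigma>\<^sub>Y\<^sup>2)) ?plugin \<theta>
      \<longleftrightarrow> risk ?f\<^sub>1 squared_error \<psi>\<^sub>\<pi> (coord1 r \<theta>) < risk ?f\<^sub>1 squared_error \<psi>\<^sub>0 (coord1 r \<theta>)" (is ?less) for \<theta>
  proof -
    have "0 < r * \<sigma>\<^sub>1\<^sup>2 / (1 + r)" using v r by simp
    from parallel_axis_mvn[OF this] obtain K where
      K: "parallel_axis (density lborel (\<lambda>w. ennreal (mvn_density (coord2 r \<theta>) (r * \<sigma>\<^sub>1\<^sup>2 / (1 + r)) w))) (\<lambda>w. w) (coord2 r \<theta>) K"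
      by blast
    (* finiteness of K makes both cancellations valid, also when a or b is infinite *)
    have affine_le: "ennreal (1 / (2 * \<sigma>\<^sub>Y\<^sup>2)) * (a + ennreal K) \<le> ennreal (1 / (2 * \<sigma>\<^sub>Y\<^sup>2)) * (b + ennreal K) \<longleftrightarrow> a \<le> b" for a b
      using vY by (subst ennreal_mult_le_mult_iff)
        (simp_all add: add.commute[of _ "ennreal K"] ennreal_add_left_cancel_le)
    note risk_eq = predictive_risk_eq[OF v r \<psi>\<^sub>\<pi>_meas loss\<^sub>\<pi> K]
      predictive_risk_eq[OF v r assms(9) loss\<^sub>0 K]
    show ?le ?less
      unfolding \<sigma>\<^sub>2 risk_eq by (simp_all only: affine_le not_le[symmetric])
  qed
  have \<Theta>: "{\<mu>. (1 + r) *\<^sub>R \<mu> \<in> A} = coord1 r ` {\<theta>. fst \<theta> - snd \<theta> \<in> A}"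
  proof (intro equalityI subsetI)
    fix \<mu> assume "\<mu> \<in> {\<mu>. (1 + r) *\<^sub>R \<mu> \<in> A}"
    moreover have "coord1 r (\<mu> + 0, 0 - r *\<^sub>R \<mu>) = \<mu>" using r by (intro coord_inverse) simp
    ultimately show "\<mu> \<in> coord1 r ` {\<theta>. fst \<theta> - snd \<theta> \<in> A}"
      by (intro image_eqI[of _ _ "(\<mu> + 0, 0 - r *\<^sub>R \<mu>)"]) (simp_all add: algebra_simps)
  next
    fix \<mu> assume "\<mu> \<in> coord1 r ` {\<theta>. fst \<theta> - snd \<theta> \<in> A}"
    then show "\<mu> \<in> {\<mu>. (1 + r) *\<^sub>R \<mu> \<in> A}" using r by (auto simp: coord1_def)
  qed
  show ?thesis
    unfolding dominates_def \<Theta> by (simp only: le_iff less_iff) blast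
qed

end
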